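(* Let $w:[0,\infty)\to[0,\infty)$ be strictly increasing and right-continuous with $w(0)=0$ and $w(1)=1$. Let $\mathbf X=(X_t)_{t\ge 0}$ be the vertex-reinforced jump process VRJP($w$) on $\mathbb Z$ started at $X_0=0$ with all initial local times equal to $1$. Then $\mathbf X$ cannot be transient, that is, $$\mathbb P\Big(\lim_{t\to\infty}|X_t|=\infty\Big)=0.$$
   Context: VRJP($w$) on $\mathbb Z$ (nearest-neighbour graph) with all initial local times equal to $1$ is the continuous-time càdlàg process $(X_t)_{t\ge0}$ with values in $\mathbb Z$ that jumps only between nearest neighbours and such that, for each $t$, conditionally on $\mathcal F_t=\sigma(X_s,s\le t)$, the probability that exactly one jump occurs in $(t,t+h]$ and that it goes to a given neighbour $v$ of $X_t$ is $w\big(1+\int_0^t\mathbf 1_{\{X_s=v\}}ds\big)h+o(h)$ as $h\downarrow0$, and the probability of more than one jump in $(t,t+h]$ is $o(h)$. *)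

theory Defs
  imports "HOL-Probability.Probability" "HOL-Library.Landau_Symbols"
begin

definition cadlag :: "(real \<Rightarrow> int) \<Rightarrow> bool" where
  "cadlag f \<longleftrightarrow>
     (\<forall>t\<ge>0. (f \<longlongrightarrow> f t) (at_right t)) \<and>
     (\<forall>t>0. \<exists>l. (f \<longlongrightarrow> l) (at_left t))"

definition nearest_neighbour_jumps :: "(real \<Rightarrow> int) \<Rightarrow> bool" where
  "nearest_neighbour_jumps f \<longleftrightarrow>
     (\<forall>t>0. \<forall>l. (f \<longlongrightarrow> l) (at_left t) \<longrightarrow> f t \<noteq> l \<longrightarrow> \<bar>f t - l\<bar> = 1)"

definition jump_times :: "(real \<Rightarrow> int) \<Rightarrow> real \<Rightarrow> real \<Rightarrow> real set" where
  "jump_times f s t = {u \<in> {s<..t}. \<not> (f \<longlongrightarrow> f u) (at_left u)}"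

definition exactly_one_jump_to :: "int \<Rightarrow> (real \<Rightarrow> int) \<Rightarrow> real \<Rightarrow> real \<Rightarrow> bool" where
  "exactly_one_jump_to v f s t \<longleftrightarrow> (\<exists>u. jump_times f s t = {u} \<and> f u = v)"

definition more_than_one_jump :: "(real \<Rightarrow> int) \<Rightarrow> real \<Rightarrow> real \<Rightarrow> bool" where
  "more_than_one_jump f s t \<longleftrightarrow>
     (\<exists>u\<in>jump_times f s t. \<exists>u'\<in>jump_times f s t. u \<noteq> u')"

definition local_time :: "(real \<Rightarrow> int) \<Rightarrow> int \<Rightarrow> real \<Rightarrow> real" where
  "local_time f v t = 1 + integral {0..t} (\<lambda>s. indicat_real {v} (f s))"

text \<open>The sigma-algebra generated by the \<open>X s\<close> with \<open>0 \<le> s \<le> t\<close>, as a measure space of which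
  only the measurable sets matter.\<close>

definition natural_filtration :: "'a measure \<Rightarrow> (real \<Rightarrow> 'a \<Rightarrow> int) \<Rightarrow> real \<Rightarrow> 'a measure" where
  "natural_filtration M X t =
     sigma (space M) {X s -` A \<inter> space M |s A. s \<in> {0..t}}"

definition cond_probability :: "'a measure \<Rightarrow> 'a measure \<Rightarrow> ('a \<Rightarrow> bool) \<Rightarrow> 'a \<Rightarrow> real" where
  "cond_probability M F P = real_cond_exp M F (indicat_real {\<omega> \<in> space M. P \<omega>})"

text \<open>The error terms are dominated by a deterministic \<open>r h\<close> which is \<open>o(h)\<close> as \<open>h\<close> tends to
  \<open>0\<close> from the right, the same \<open>r\<close> serving all \<open>t\<close> in a bounded interval. Uniformity matters: if
  \<open>r\<close> could depend on \<open>t\<close> or on \<open>\<omega>\<close>, then the conditions would not determine the law of the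
  process, since an additional jump could be forced at a fixed time \<open>t\<^sub>0\<close> (for \<open>t < t\<^sub>0\<close> it is
  invisible once \<open>h < t\<^sub>0 - t\<close>, and for \<open>t \<ge> t\<^sub>0\<close> it does not lie in \<open>(t, t + h]\<close>). The
  process that jumps at the prescribed rates satisfies the uniform condition with \<open>r h = C * h\<^sup>2\<close>
  for small \<open>h\<close>, since up to time \<open>t\<close> the
  rate of a jump to any given site is at most \<open>w (1 + t)\<close>.\<close>

locale vrjp = prob_space M
  for M :: "'a measure" and w :: "real \<Rightarrow> real" and X :: "real \<Rightarrow> 'a \<Rightarrow> int" +
  assumes measurable_X: "\<And>t. 0 \<le> t \<Longrightarrow> X t \<in> measurable M (count_space UNIV)"
    and cadlag_paths: "\<And>\<omega>. \<omega> \<in> space M \<Longrightarrow> cadlag (\<lambda>t. X t \<omega>)"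
    and nearest_neighbour: "\<And>\<omega>. \<omega> \<in> space M \<Longrightarrow> nearest_neighbour_jumps (\<lambda>t. X t \<omega>)"
    and jump_rates: "\<And>T. 0 \<le> T \<Longrightarrow> \<exists>r \<in> o[at_right 0](\<lambda>h. h). \<forall>t\<in>{0..T}. \<forall>h>0.
      (\<forall>v. AE \<omega> in M. \<bar>v - X t \<omega>\<bar> = 1 \<longrightarrow>
         \<bar>cond_probability M (natural_filtration M X t)
              (\<lambda>\<omega>'. exactly_one_jump_to v (\<lambda>s. X s \<omega>') t (t + h)) \<omega>
            - w (local_time (\<lambda>s. X s \<omega>) v t) * h\<bar> \<le> r h) \<and>
      (AE \<omega> in M.
         cond_probability M (natural_filtration M X t)
              (\<lambda>\<omega>'. more_than_one_jump (\<lambda>s. X s \<omega>') t (t + h)) \<omega> \<le> r h)"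

end

theory Submission
  imports Defs
begin

text \<open>
  Attach to the edge \<open>{x, x + 1}\<close> the local times \<open>a\<close> of \<open>x\<close> and \<open>b\<close> of \<open>x + 1\<close>, and let
  \<open>W' = 1/w\<close>, \<open>W 1 = 0\<close>. Weighting a crossing of the edge by \<open>1/(w a * w b)\<close> exactly compensates
  \<open>W a - W b\<close>, so \<open>W b - W a + 1{X > x}/(w a * w b)\<close> is a supermartingale. Since \<open>w 2 > 1\<close>, there
  is a definite gain whenever the walk first crosses the edge: with probability bounded away from
  \<open>0\<close> the local time of \<open>x\<close> is then at most \<open>2\<close> and the local time of \<open>x + 1\<close> reaches \<open>2\<close> before the
  walk returns. Hence the indicator can be replaced by potentials such that the supermartingale starts
  at \<open>- eta/4\<close> and ends at \<open>W b - W a\<close> or more if the walk finishes on the right. Summing over the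
  edges between \<open>0\<close> and \<open>n\<close>, the terms \<open>W\<close> telescope, and stopping softly when the local time
  of \<open>0\<close> reaches \<open>K\<close> shows that the walk is beyond \<open>n\<close> with local time at most \<open>K - 1\<close> at \<open>0\<close> with probability
  at most \<open>(K - 1)\<^sup>2 / (n * eta/4)\<close>, uniformly in time. On the event of escape the local time of \<open>0\<close> is bounded
  while \<open>n\<close> is arbitrary; the escape to \<open>-\<infinity>\<close> is the same statement for \<open>-X\<close>.
\<close>

section \<open>Potentials of a single edge and their generator inequalities\<close>

locale reinforcement_weight =
  fixes w :: "real \<Rightarrow> real"
  assumes w_mono: "\<And>x y. 1 \<le> x \<Longrightarrow> x \<le> y \<Longrightarrow> w x \<le> w y"
    and w_1: "w 1 = 1"
    and w_2: "1 < w 2"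
begin

definition W :: "real \<Rightarrow> real" where
  "W l = integral {1..l} (\<lambda>u. 1 / w u)"

text \<open>The gain per edge is a fixed multiple of this constant. The divisor
  \<open>exp (2 * w 2)\<close> is the largest value of the exponential profile in
  \<open>right_potential\<close>, reached at the cap \<open>b = 3\<close>; the numerator is what
  keeps that potential nonnegative. Positivity is where \<open>1 < w 2\<close> enters.\<close>

definition eta :: real where
  "eta = (1 / w 2) * (1 - 1 / w 2) / exp (2 * w 2)"

text \<open>
  The potentials are the third summand of the supermartingale when the walk is to the right or to the
  left of the edge. On the right, the second argument of \<open>min\<close> is the compensating weight. The first one
  replaces its decrease in \<open>b\<close>, which may be concentrated in jumps or be singular, by an exponential
  profile on \<open>b < 2\<close>; it is irrelevant for \<open>2 \<le> b\<close>, and the cap at \<open>3\<close> only keeps it bounded. On the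
  left, \<open>b = 1\<close> encodes that the edge has not been crossed yet.
\<close>

definition right_potential :: "real \<Rightarrow> real \<Rightarrow> real" where
  "right_potential a b =
     min (1 / w a - eta * max 0 (2 - a) * exp (w 2 * (min b 3 - 1))) (1 / (w a * w b))"

definition left_potential :: "real \<Rightarrow> real \<Rightarrow> real" where
  "left_potential a b = (if b = 1 then - (eta / 4 * (max 0 (2 - a))\<^sup>2) else 0)"

lemma w_ge_1: "1 \<le> x \<Longrightarrow> 1 \<le> w x"
  using w_mono[of 1 x] by (simp add: w_1)

lemma inverse_w_antimono: "1 \<le> x \<Longrightarrow> x \<le> y \<Longrightarrow> 1 / w y \<le> 1 / w x"
  using w_mono[of x y] w_ge_1[of x] by (intro divide_left_mono) auto

lemma inverse_w_integrable: "1 \<le> x \<Longrightarrow> (\<lambda>u. 1 / w u) integrable_on {x..y}"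
proof -
  assume x: "1 \<le> x"
  have "(\<lambda>u. - (1 / w u)) integrable_on {x..y}"
    by (rule integrable_on_mono_on) (auto intro!: monotone_onI inverse_w_antimono[simplified] simp: x order_trans[OF x])
  from integrable_neg[OF this] show ?thesis by simp
qed

lemma W_1: "W 1 = 0"
  by (simp add: W_def)

text \<open>Since \<open>1 / w\<close> is antitone, its integral over an interval is squeezed
  between the endpoint values. These bounds stand in for the derivative of \<open>W\<close>, which
  need not exist where \<open>w\<close> jumps.\<close>

lemma W_increment:
  assumes "1 \<le> x" "x \<le> y"
  shows "(y - x) / w y \<le> W y - W x" "W y - W x \<le> (y - x) / w x"
proof -
  have eq: "W y - W x = integral {x..y} (\<lambda>u. 1 / w u)"
    unfolding W_def using Henstock_Kurzweil_Integration.integral_combine[of 1 x y "\<lambda>u. 1 / w u"]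
      inverse_w_integrable[of 1 y] assms by simp
  have "integral {x..y} (\<lambda>u. 1 / w y) \<le> integral {x..y} (\<lambda>u. 1 / w u)"
    using assms by (intro integral_le inverse_w_integrable integrable_const_ivl inverse_w_antimono) auto
  then show "(y - x) / w y \<le> W y - W x"
    using assms by (simp add: eq)
  have "integral {x..y} (\<lambda>u. 1 / w u) \<le> integral {x..y} (\<lambda>u. 1 / w x)"
    using assms by (intro integral_le inverse_w_integrable integrable_const_ivl inverse_w_antimono) auto
  then show "W y - W x \<le> (y - x) / w x"
    using assms by (simp add: eq)
qed

lemma W_mono: "1 \<le> x \<Longrightarrow> x \<le> y \<Longrightarrow> W x \<le> W y"
  using order_trans[OF divide_nonneg_pos[of "y - x" "w y"] W_increment(1)[of x y]] w_ge_1[of y] by simp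

lemma W_lipschitz: "1 \<le> x \<Longrightarrow> x \<le> y \<Longrightarrow> W y - W x \<le> y - x"
  using W_increment(2)[of x y] w_ge_1[of x] divide_left_mono[of 1 "w x" "y - x"] by simp

lemma W_nonneg: "1 \<le> x \<Longrightarrow> 0 \<le> W x"
  using W_mono[of 1 x] by (simp add: W_1)

lemma W_le: "1 \<le> x \<Longrightarrow> W x \<le> x - 1"
  using W_lipschitz[of 1 x] by (simp add: W_1)

lemma eta_pos: "0 < eta"
  using w_2 by (simp add: eta_def)

lemma eta_exp: "eta * exp (2 * w 2) = (1 / w 2) * (1 - 1 / w 2)"
  by (simp add: eta_def)

lemma eta_exp_le: 
  assumes "1 \<le> b"
  shows "eta * exp (w 2 * (min b 3 - 1)) \<le> (1 / w 2) * (1 - 1 / w 2)"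
proof -
  have "w 2 * (min b 3 - 1) \<le> w 2 * 2"
    using w_2 by (intro mult_left_mono) auto
  then have "eta * exp (w 2 * (min b 3 - 1)) \<le> eta * exp (2 * w 2)"
    using eta_pos by (simp add: mult.commute)
  then show ?thesis by (simp add: eta_exp)
qed

text \<open>The ramp vanishes for \<open>2 \<le> a\<close>; for \<open>a < 2\<close> the choice of
  \<open>eta\<close> and \<open>1 / w 2 \<le> 1 / w a\<close> suffice. The point is that the first
  argument of the minimum in \<open>right_potential\<close> is thus at least
  \<open>1 / (w a * w 2)\<close>: the potential is nonnegative, and for \<open>2 \<le> b\<close> the
  minimum is the compensating weight.\<close>

lemma ramp_le:
  assumes "1 \<le> a" "1 \<le> b"
  shows "eta * max 0 (2 - a) * exp (w 2 * (min b 3 - 1)) \<le> (1 / w a) * (1 - 1 / w 2)"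
proof (cases "a < 2")
  case True
  have "max 0 (2 - a) * (eta * exp (w 2 * (min b 3 - 1))) \<le> 1 * ((1 / w 2) * (1 - 1 / w 2))"
    using assms w_2 eta_pos by (intro mult_mono eta_exp_le) auto
  also have "\<dots> \<le> (1 / w a) * (1 - 1 / w 2)"
    using True assms w_2 inverse_w_antimono[of a 2] mult_right_mono[of "1 / w 2" "1 / w a" "1 - 1 / w 2"] by simp
  finally show ?thesis by (simp add: ac_simps)
next
  case False
  then show ?thesis using w_2 w_ge_1[of a] assms by simp
qed

lemma right_potential_nonneg: "1 \<le> a \<Longrightarrow> 1 \<le> b \<Longrightarrow> 0 \<le> right_potential a b"
proof -
  assume ab: "1 \<le> a" "1 \<le> b"
  have "(1 / w a) * (1 - 1 / w 2) \<le> (1 / w a) * 1"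
    using w_2 w_ge_1[of a] ab by (intro mult_left_mono) auto
  then show ?thesis
    using ramp_le[OF ab] w_ge_1[of a] w_ge_1[of b] ab by (simp add: right_potential_def)
qed

lemma right_potential_le: "right_potential a b \<le> 1 / (w a * w b)"
  by (simp add: right_potential_def)

lemma right_potential_le_1:
  assumes "1 \<le> a" "1 \<le> b" shows "right_potential a b \<le> 1"
proof -
  have "1 \<le> w a * w b"
    using mult_mono[OF w_ge_1[OF assms(1)] w_ge_1[OF assms(2)]] w_ge_1[OF assms(1)] by simp
  then show ?thesis
    using right_potential_le[of a b] divide_le_eq_1[of 1 "w a * w b"] by linarith
qed

lemma left_potential_nonpos: "left_potential a b \<le> 0"
  using eta_pos by (simp add: left_potential_def)

lemma eta_le_1: "eta \<le> 1"
proof -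
  have "eta \<le> eta * exp (2 * w 2)"
    using eta_pos w_2 by simp
  also have "\<dots> \<le> 1 * 1"
    unfolding eta_exp using w_2 by (intro mult_mono) auto
  finally show ?thesis by simp
qed

lemma left_potential_ge: 
  assumes "1 \<le> a"
  shows "- (eta / 4) \<le> left_potential a b"
proof -
  have "(max 0 (2 - a))\<^sup>2 \<le> 1"
    using assms by (intro power_le_one) auto
  then have "eta / 4 * (max 0 (2 - a))\<^sup>2 \<le> eta / 4 * 1"
    using eta_pos by (intro mult_left_mono) auto
  then show ?thesis using eta_pos by (simp add: left_potential_def)
qed

lemma left_potential_1_1: "left_potential 1 1 = - (eta / 4)"
  by (simp add: left_potential_def)

text \<open>As a function of \<open>a\<close> the potential is concave, so the increment stays below
  the tangent at the left endpoint.\<close>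

lemma left_potential_increment:
  assumes "a \<le> a'" 
  shows "left_potential a' b - left_potential a b \<le> (if b = 1 then eta / 2 * max 0 (2 - a) * (a' - a) else 0)"
proof -
  define u v where "u = max 0 (2 - a)" and "v = max 0 (2 - a')"
  have uv: "0 \<le> v" "v \<le> u" "u - v \<le> a' - a"
    using assms by (auto simp: u_def v_def)
  have "u\<^sup>2 - v\<^sup>2 = (u + v) * (u - v)" by (simp add: power2_eq_square algebra_simps)
  also have "\<dots> \<le> (2 * u) * (a' - a)"
    using uv by (intro mult_mono) auto
  finally have "eta / 4 * (u\<^sup>2 - v\<^sup>2) \<le> eta / 4 * ((2 * u) * (a' - a))"
    using eta_pos by (intro mult_left_mono) auto
  then show ?thesis by (simp add: left_potential_def algebra_simps flip: u_def v_def)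
qed

text \<open>Only the ramp lets the potential grow, and only through \<open>a\<close>, with slope at
  most \<open>eta\<close> times the exponential, which is at most 1. Everything else is antitone in
  both local times.\<close>

lemma right_potential_increment:
  assumes "1 \<le> a" "a \<le> a'" "1 \<le> b" "b \<le> b'"
  shows "right_potential a' b' - right_potential a b \<le> a' - a"
proof -
  let ?E = "\<lambda>b. exp (w 2 * (min b 3 - 1))"
  have 1: "1 / (w a' * w b') \<le> 1 / (w a * w b)"
    using assms w_ge_1[of a] w_ge_1[of b] w_mono by (intro divide_left_mono mult_mono mult_pos_pos) force+
  have 2: "1 / w a' \<le> 1 / w a"
    using assms by (intro inverse_w_antimono)
  have E: "?E b \<le> ?E b'"
    using assms w_2 by (simp add: mult_left_mono)
  have le1: "eta * ?E b \<le> 1"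
  proof -
    have "(1 / w 2) * (1 - 1 / w 2) \<le> 1 * 1"
      using w_2 by (intro mult_mono) auto
    then show ?thesis using eta_exp_le[of b] assms by simp
  qed
  have "eta * max 0 (2 - a) * ?E b - eta * max 0 (2 - a') * ?E b'
      \<le> eta * max 0 (2 - a) * ?E b - eta * max 0 (2 - a') * ?E b"
    using E eta_pos by (simp add: mult_left_mono)
  also have "\<dots> = (max 0 (2 - a) - max 0 (2 - a')) * (eta * ?E b)"
    by (simp add: algebra_simps)
  also have "\<dots> \<le> (a' - a) * 1"
    using assms le1 eta_pos by (intro mult_mono) auto
  finally have 3: "1 / w a' - eta * max 0 (2 - a') * ?E b' \<le> 1 / w a - eta * max 0 (2 - a) * ?E b + (a' - a)"
    using 2 by simp
  have "right_potential a' b' \<le> right_potential a b + (a' - a)"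
    using 1 3 assms unfolding right_potential_def min_add_distrib_left by (intro min.mono) auto
  then show ?thesis by simp
qed

text \<open>The walk sits at the left end for time \<open>h\<close>: only \<open>a\<close> grows,
  and a crossing to the right has rate \<open>w b\<close>. As
  \<open>w b * right_potential a b \<le> 1 / w a\<close>, the expected gain of a crossing is paid
  for by the growth of \<open>W a\<close>. The term \<open>h * (1 / w (a + h) - 1 / w a)\<close> is
  the change of the correction in \<open>edge_value\<close>; it makes up for the fact that the
  growth of \<open>W\<close> is only bounded below by \<open>h / w (a + h)\<close>.\<close>

lemma left_generator:
  assumes "1 \<le> a" "1 \<le> b" "0 \<le> h"
  shows "- (W (a + h) - W a) + (left_potential (a + h) b - left_potential a b)
     + h * (1 / w (a + h) - 1 / w a) \<le> - (h * (w b * (right_potential a b - left_potential a b)))"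
proof -
  have W: "h / w (a + h) \<le> W (a + h) - W a"
    using W_increment(1)[of a "a + h"] assms by simp
  have wb: "1 \<le> w b" using assms w_ge_1 by simp
  have key: "left_potential (a + h) b - left_potential a b + h * (w b * (right_potential a b - left_potential a b)) \<le> h / w a"
  proof (cases "b = 1")
    case False
    have "w b * right_potential a b \<le> w b * (1 / (w a * w b))"
      using wb by (intro mult_left_mono right_potential_le) auto
    also have "\<dots> = 1 / w a" using wb by simp
    finally have "h * (w b * right_potential a b) \<le> h * (1 / w a)"
      using assms by (intro mult_left_mono) auto
    then show ?thesis using False by (simp add: left_potential_def)
  next
    case True
    define u where "u = max 0 (2 - a)"
    have u: "0 \<le> u" "u \<le> 1" using assms by (auto simp: u_def)
    have "right_potential a b \<le> 1 / w a - eta * u"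
      by (simp add: right_potential_def True u_def w_1)
    then have "h * (right_potential a b - left_potential a b) \<le> h * (1 / w a - eta * u + eta / 4 * u\<^sup>2)"
      using assms by (intro mult_left_mono) (auto simp: left_potential_def True u_def)
    moreover have "left_potential (a + h) b - left_potential a b \<le> eta / 2 * u * h"
      using left_potential_increment[of a "a + h" b] assms by (simp add: True u_def)
    \<comment> \<open>Budget of an uncrossed edge, per unit time and in units of \<open>eta\<close>:
      the left potential rises by at most \<open>u / 2\<close>, the ramp at \<open>b = 1\<close>
      withholds \<open>u\<close> from the gain of a crossing, and leaving the negative left
      potential gives back a quarter of the square of \<open>u\<close>.\<close>
    moreover have "h * (eta * (u / 2 - u + 1 / 4 * u\<^sup>2)) \<le> 0"
    proof -
      have "u\<^sup>2 \<le> u" using u by (simp add: power2_eq_square mult_left_le)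
      then have "u / 2 - u + 1 / 4 * u\<^sup>2 \<le> 0" using u by simp
      then show ?thesis using assms eta_pos by (simp add: mult_nonneg_nonpos)
    qed
    ultimately show ?thesis by (simp add: True w_1 algebra_simps)
  qed
  then show ?thesis using W by (simp add: algebra_simps)
qed

text \<open>The walk sits at the right end: only \<open>b\<close> grows, and a crossing to the left
  has rate \<open>w a\<close> and loses \<open>right_potential a b\<close>. Where the compensating
  weight is the minimum, the loss is exactly \<open>1 / w b\<close> per unit time and balances
  \<open>W\<close>. Where the ramp is active, the loss is too small by \<open>w a\<close> times the
  ramp, and the growth of the ramp in \<open>b\<close> at exponential rate
  \<open>w 2 \<ge> w a\<close> covers this.\<close>

lemma right_generator:
  assumes a: "1 \<le> a" and b: "1 \<le> b" and h: "0 \<le> h" "h \<le> 1"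
  shows "W (b + h) - W b + (right_potential a (b + h) - right_potential a b)
     \<le> - (h * (w a * - right_potential a b))"
proof -
  let ?E = "\<lambda>b. exp (w 2 * (min b 3 - 1))"
  define e where "e = eta * max 0 (2 - a)"
  have W: "W (b + h) - W b \<le> h / w b"
    using W_increment(2)[of b "b + h"] b h by simp
  have wa: "1 \<le> w a" and wb: "1 \<le> w b" using a b w_ge_1 by auto
  have "right_potential a (b + h) - right_potential a b - h * (w a * right_potential a b) \<le> - (h / w b)"
  proof (cases "1 / (w a * w b) \<le> 1 / w a - e * ?E b")
    case True
    then have eq: "right_potential a b = 1 / (w a * w b)"
      by (simp add: right_potential_def e_def)
    have "right_potential a (b + h) \<le> right_potential a b"
      using right_potential_increment[of a a b "b + h"] a b h by simp
    then show ?thesis using wa by (simp add: eq)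
  next
    case False
    then have eq: "right_potential a b = 1 / w a - e * ?E b"
      by (simp add: right_potential_def e_def)
    \<comment> \<open>The first argument can be the strict minimum only where the ramp is nonzero,
      and by \<open>ramp_le\<close> only for \<open>b < 2\<close>.\<close>
    have a2: "a < 2"
    proof (rule ccontr)
      assume "\<not> a < 2"
      then have "e = 0" by (simp add: e_def)
      moreover have "1 / (w a * w b) \<le> 1 / w a"
        using wa wb by (simp add: field_simps)
      ultimately show False using False by simp
    qed
    have b2: "b < 2"
    proof (rule ccontr)
      assume "\<not> b < 2"
      then have "1 / w b \<le> 1 / w 2" by (intro inverse_w_antimono) auto
      then have "(1 / w a) * (1 / w b) \<le> (1 / w a) * (1 / w 2)"
        using wa by (intro mult_left_mono) auto
      moreover have "e * ?E b \<le> (1 / w a) * (1 - 1 / w 2)"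
        using ramp_le[OF a b] by (simp add: e_def)
      ultimately show False using False by (simp add: algebra_simps)
    qed
    have e: "0 \<le> e" using eta_pos by (simp add: e_def)
    have "?E b + h * w 2 * ?E b = ?E b * (1 + w 2 * h)" by (simp add: algebra_simps)
    also have "\<dots> \<le> ?E b * exp (w 2 * h)"
      by (intro mult_left_mono exp_ge_add_one_self) auto
    \<comment> \<open>\<open>b < 2\<close> and \<open>h \<le> 1\<close> keep \<open>b + h\<close>
      below 3, so the cap is invisible at both ends of the step.\<close>
    also have "\<dots> = ?E (b + h)"
      using b2 h by (simp add: algebra_simps flip: exp_add)
    finally have "e * (?E b + h * w 2 * ?E b) \<le> e * ?E (b + h)"
      using e by (intro mult_left_mono)
    moreover have "right_potential a (b + h) \<le> 1 / w a - e * ?E (b + h)"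
      by (simp add: right_potential_def e_def)
    ultimately have 1: "right_potential a (b + h) - right_potential a b \<le> - (h * (w 2 * (e * ?E b)))"
      using eq by (simp add: algebra_simps)
    have 2: "w a * right_potential a b = 1 - w a * (e * ?E b)"
      using wa by (simp add: eq right_diff_distrib)
    have "w a * (e * ?E b) \<le> w 2 * (e * ?E b)"
      using a a2 e by (intro mult_right_mono w_mono) auto
    then have "1 / w b - w 2 * (e * ?E b) - (1 - w a * (e * ?E b)) \<le> 0"
      using divide_le_eq_1[of 1 "w b"] wb by linarith
    then have "h * (1 / w b - w 2 * (e * ?E b) - (1 - w a * (e * ?E b))) \<le> 0"
      using h by (simp add: mult_nonneg_nonpos)
    then show ?thesis
      using 1 unfolding 2 by (simp add: algebra_simps)
  qed
  then show ?thesis using W by simp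
qed

end

section \<open>Jumps of cadlag integer-valued paths\<close>

lemma cadlag_at_right:
  assumes "cadlag f" "0 \<le> t"
  shows "eventually (\<lambda>u. f u = f t) (at_right t)"
  using assms by (simp add: cadlag_def tendsto_discrete)

lemma jump_times_iff:
  "u \<in> jump_times f s t \<longleftrightarrow> s < u \<and> u \<le> t \<and> \<not> eventually (\<lambda>x. f x = f u) (at_left u)"
  by (auto simp: jump_times_def tendsto_discrete)

text \<open>A locally constant function on a connected interval is constant. Right-continuity gives
  local constancy on the right, absence of a jump gives it on the left; at \<open>s\<close> itself
  only the right side lies in the interval, so a jump exactly at \<open>s\<close> is
  harmless.\<close>

lemma constant_without_jumps:
  assumes f: "cadlag f" and st: "0 \<le> s" "jump_times f s t = {}" "u \<in> {s..t}"
  shows "f u = f s"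
proof -
  have "f s = f u"
  proof (rule connected_local_const[of "{s..t}"])
    show "\<forall>a\<in>{s..t}. eventually (\<lambda>b. f a = f b) (at a within {s..t})"
    proof
      fix a assume a: "a \<in> {s..t}"
      have R: "eventually (\<lambda>b. f a = f b) (at_right a)"
        by (rule eventually_mono[OF cadlag_at_right[OF f]]) (use a st in auto)
      show "eventually (\<lambda>b. f a = f b) (at a within {s..t})"
      proof (cases "a = s")
        case True
        have "at a within {s..t} \<le> at_right a"
          unfolding at_within_def True by (intro inf_mono order_refl) auto
        then show ?thesis using R filter_leD by blast
      next
        case False
        then have "a \<notin> jump_times f s t" "s < a" "a \<le> t" using a st by auto
        then have "eventually (\<lambda>b. f b = f a) (at_left a)"
          by (simp add: jump_times_iff)
        then have "eventually (\<lambda>b. f a = f b) (at_left a)"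
          by (rule eventually_mono) simp
        then have "eventually (\<lambda>b. f a = f b) (at a)"
          using R by (simp add: eventually_at_split)
        then show ?thesis using at_le[of "{s..t}" UNIV a] filter_leD by blast
      qed
    qed
  qed (use st in auto)
  then show ?thesis by simp
qed

lemma eventually_at_left_interval:
  fixes u :: real
  assumes "s < u" "\<And>x. s < x \<Longrightarrow> x < u \<Longrightarrow> P x"
  shows "eventually P (at_left u)"
  using assms by (auto simp: eventually_at_left_field)

lemma exactly_one_jump_path:
  assumes f: "cadlag f" and s: "0 \<le> s" and J: "exactly_one_jump_to v f s t"
  obtains u where "s < u" "u \<le> t" "\<And>x. s \<le> x \<Longrightarrow> x < u \<Longrightarrow> f x = f s"
    "\<And>x. u \<le> x \<Longrightarrow> x \<le> t \<Longrightarrow> f x = v" "v \<noteq> f s"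
proof -
  obtain u where u: "jump_times f s t = {u}" "f u = v"
    using J by (auto simp: exactly_one_jump_to_def)
  have su: "s < u" "u \<le> t" and nl: "\<not> eventually (\<lambda>x. f x = f u) (at_left u)"
    using u(1) jump_times_iff[of u f s t] by auto
  have left: "f x = f s" if "s \<le> x" "x < u" for x
  proof (rule constant_without_jumps[OF f s, of x])
    show "jump_times f s x = {}"
    proof -
      have "y \<notin> jump_times f s x" for y
      proof
        assume "y \<in> jump_times f s x"
        then have "y \<in> jump_times f s t" using that su by (auto simp: jump_times_iff)
        then show False using u \<open>y \<in> jump_times f s x\<close> that by (auto simp: jump_times_iff)
      qed
      then show ?thesis by auto
    qed
  qed (use that in auto)
  have right: "f x = v" if "u \<le> x" "x \<le> t" for x
  proof -
    have "jump_times f u t = {}"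
    proof -
      have "y \<notin> jump_times f u t" for y
      proof
        assume y: "y \<in> jump_times f u t"
        then have "y \<in> jump_times f s t" using su by (auto simp: jump_times_iff)
        then show False using u y by (auto simp: jump_times_iff)
      qed
      then show ?thesis by auto
    qed
    from constant_without_jumps[OF f _ this, of x] show ?thesis using that u s su by auto
  qed
  have v: "v \<noteq> f s"
  proof
    assume "v = f s"
    then have "f x = f u" if "s < x" "x < u" for x
      using left[of x] u that by simp
    then have "eventually (\<lambda>x. f x = f u) (at_left u)"
      using su by (intro eventually_at_left_interval[of s])
    then show False using nl by simp
  qed
  show ?thesis
    by (rule that[of u], fact su(1), fact su(2), erule (1) left, erule (1) right, fact v)
qed

lemma exactly_one_jump_neighbour:
  assumes f: "cadlag f" "nearest_neighbour_jumps f" and s: "0 \<le> s" and J: "exactly_one_jump_to v f s t"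
  shows "\<bar>v - f s\<bar> = 1"
proof -
  obtain u where u: "s < u" "u \<le> t" "\<And>x. s \<le> x \<Longrightarrow> x < u \<Longrightarrow> f x = f s"
    "\<And>x. u \<le> x \<Longrightarrow> x \<le> t \<Longrightarrow> f x = v" "v \<noteq> f s"
    by (rule exactly_one_jump_path[OF f(1) s J], rule that)
  have "(f \<longlongrightarrow> f s) (at_left u)"
    unfolding tendsto_discrete by (rule eventually_at_left_interval[OF u(1)], rule u(3)) auto
  moreover have "f u \<noteq> f s" "0 < u" using u(1,2,5) u(4)[of u] s by auto
  ultimately have "\<bar>f u - f s\<bar> = 1"
    using f(2) by (auto simp: nearest_neighbour_jumps_def)
  then show ?thesis using u(2) u(4)[of u] by simp
qed

text \<open>Every value of the path is repeated at a rational time slightly later. This is what lets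
  the jump events and the escape event be described by countably many times, hence be
  measurable.\<close>

lemma cadlag_rational:
  assumes "cadlag f" "0 \<le> x" "x < y"
  shows "\<exists>q\<in>\<rat>. x < q \<and> q < y \<and> f q = f x"
proof -
  obtain b where b: "x < b" "\<And>z. x < z \<Longrightarrow> z < b \<Longrightarrow> f z = f x"
    using cadlag_at_right[OF assms(1,2)] by (auto simp: eventually_at_right_field)
  obtain q where "q \<in> \<rat>" "x < q" "q < min b y"
    using Rats_dense_in_real[of x "min b y"] b assms by auto
  then show ?thesis using b by auto
qed

lemma no_jump_iff:
  assumes f: "cadlag f" and s: "0 \<le> s" "s < t"
  shows "jump_times f s t = {} \<longleftrightarrow> f t = f s \<and> (\<forall>q\<in>\<rat>. s < q \<and> q < t \<longrightarrow> f q = f s)"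
proof
  assume "jump_times f s t = {}"
  then have c: "f u = f s" if "s \<le> u" "u \<le> t" for u
    using constant_without_jumps[OF f s(1), of t u] that by simp
  have "f t = f s" by (rule c) (use s in auto)
  moreover have "f q = f s" if "s < q" "q < t" for q by (rule c) (use that in auto)
  ultimately show "f t = f s \<and> (\<forall>q\<in>\<rat>. s < q \<and> q < t \<longrightarrow> f q = f s)" by blast
next
  assume R: "f t = f s \<and> (\<forall>q\<in>\<rat>. s < q \<and> q < t \<longrightarrow> f q = f s)"
  have c: "f x = f s" if xs: "s \<le> x" "x \<le> t" for x
  proof (cases "x = t")
    case False
    then have "0 \<le> x" "x < t" using xs s by auto
    from cadlag_rational[OF f this] obtain q where q: "q \<in> \<rat>" "x < q" "q < t" "f q = f x"
      by blast
    have "f q = f s" using R q(1,3) le_less_trans[OF xs(1) q(2)] by blast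
    then show ?thesis by (simp only: q(4))
  next
    case True
    then show ?thesis using R by blast
  qed
  have "u \<notin> jump_times f s t" for u
  proof
    assume u: "u \<in> jump_times f s t"
    then have su: "s < u" "u \<le> t" by (simp_all add: jump_times_iff)
    have "f x = f u" if "s < x" "x < u" for x
      using c[of x] c[of u] su that by simp
    then have "eventually (\<lambda>x. f x = f u) (at_left u)"
      by (intro eventually_at_left_interval[OF su(1)])
    then show False using u by (simp add: jump_times_iff)
  qed
  then show "jump_times f s t = {}" by auto
qed

text \<open>A description by countably many coordinates, for measurability. Two values on the
  rationals with \<open>v\<close> absorbing extend to all times by \<open>cadlag_rational\<close>,
  and the jump time is the first time at \<open>v\<close>. The endpoint \<open>t\<close> has a
  condition of its own because no rational to its right lies in the interval.\<close>

lemma exactly_one_jump_iff: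
  assumes f: "cadlag f" and s: "0 \<le> s" "s < t"
  shows "exactly_one_jump_to v f s t \<longleftrightarrow> f s \<noteq> v \<and> f t = v \<and>
    (\<forall>q\<in>\<rat>. s < q \<and> q < t \<longrightarrow> (f q = f s \<or> f q = v)) \<and>
    (\<forall>q\<in>\<rat>. \<forall>q'\<in>\<rat>. s < q \<and> s < q' \<and> q < q' \<and> q' < t \<longrightarrow> f q = v \<longrightarrow> f q' = v)"
  (is "_ \<longleftrightarrow> ?R")
proof
  assume J: "exactly_one_jump_to v f s t"
  obtain u where u: "s < u" "u \<le> t" "\<And>x. s \<le> x \<Longrightarrow> x < u \<Longrightarrow> f x = f s"
    "\<And>x. u \<le> x \<Longrightarrow> x \<le> t \<Longrightarrow> f x = v" "v \<noteq> f s"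
    by (rule exactly_one_jump_path[OF f s(1) J], rule that)
  have 1: "f q = f s \<or> f q = v" if "s < q" "q < t" for q
  proof (cases "q < u")
    case True
    then have "f q = f s" using that by (intro u(3)) auto
    then show ?thesis ..
  next
    case False
    then have "f q = v" using that by (intro u(4)) auto
    then show ?thesis ..
  qed
  have 2: "f q' = v" if q: "s < q" "q < q'" "q' < t" "f q = v" for q q'
  proof (rule u(4))
    have "\<not> q < u" using u(3)[of q] u(5) q by auto
    then show "u \<le> q'" using q by simp
  qed (use q in simp)
  have "f t = v" by (rule u(4)) (use u(2) in auto)
  then show ?R using u(5) 1 2 by blast
next
  assume R: ?R
  then have R1: "f s \<noteq> v" and R2: "f t = v" by blast+
  have R3: "f q = f s \<or> f q = v" if "q \<in> \<rat>" "s < q" "q < t" for q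
    using R that by blast
  have R4: "f q' = v" if "q \<in> \<rat>" "q' \<in> \<rat>" "s < q" "s < q'" "q < q'" "q' < t" "f q = v" for q q'
    using R that by blast
  have val: "f x = f s \<or> f x = v" if xs: "s \<le> x" "x \<le> t" for x
  proof (cases "x = t")
    case False
    then have "0 \<le> x" "x < t" using xs s by auto
    from cadlag_rational[OF f this] obtain q where q: "q \<in> \<rat>" "x < q" "q < t" "f q = f x"
      by blast
    show ?thesis using R3[OF q(1) le_less_trans[OF xs(1) q(2)] q(3)] by (simp only: q(4))
  qed (simp add: R2)
  have mono: "f y = v" if xy: "s \<le> x" "x \<le> y" "y \<le> t" "f x = v" for x y
  proof (cases "y = t \<or> y = x")
    case False
    then have 0: "0 \<le> x" "x < y" "0 \<le> y" "y < t" using xy s by auto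
    from cadlag_rational[OF f 0(1,2)] obtain q where q: "q \<in> \<rat>" "x < q" "q < y" "f q = f x"
      by blast
    from cadlag_rational[OF f 0(3,4)] obtain q' where q': "q' \<in> \<rat>" "y < q'" "q' < t" "f q' = f y"
      by blast
    have "f q' = v"
      by (rule R4[OF q(1) q'(1)]) (use q q' xy in simp_all)
    then show ?thesis by (simp only: q'(4))
  qed (use R2 xy in auto)
  define S where "S = {x \<in> {s..t}. f x = v}"
  define u where "u = Inf S"
  have S: "x \<in> S \<longleftrightarrow> s \<le> x \<and> x \<le> t \<and> f x = v" for x by (simp add: S_def)
  have tS: "t \<in> S" using R2 s by (simp add: S)
  have bdd: "bdd_below S" by (intro bdd_belowI[of _ s]) (simp add: S)
  have u: "s \<le> u" "u \<le> t"
    unfolding u_def using tS bdd by (auto simp: S intro!: cInf_greatest cInf_lower)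
  have above: "f x = v" if ux: "u < x" "x \<le> t" for x
  proof -
    have "Inf S < x" "S \<noteq> {}" using ux tS by (auto simp: u_def)
    then obtain y where "y \<in> S" "y < x"
      using cInf_lessD by blast
    then show ?thesis using mono[of y x] ux by (simp add: S)
  qed
  \<comment> \<open>The infimum is attained: a rational just after \<open>u\<close> carries both the
    value \<open>f u\<close> and the value \<open>v\<close>.\<close>
  have fu: "f u = v"
  proof (cases "u = t")
    case False
    then have "0 \<le> u" "u < t" using u s by auto
    from cadlag_rational[OF f this] obtain q where "q \<in> \<rat>" "u < q" "q < t" "f q = f u"
      by blast
    then show ?thesis using above[of q] by simp
  qed (simp add: R2)
  have below: "f x = f s" if xs: "s \<le> x" "x < u" for x
  proof -
    have "x \<notin> S" using cInf_lower[OF _ bdd, of x] xs by (auto simp: u_def)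
    then show ?thesis using val[of x] xs u by (simp add: S)
  qed
  have su: "s < u" using u fu R1 by (cases "s = u") auto
  have "y \<in> jump_times f s t \<longleftrightarrow> y = u" for y
  proof
    assume y: "y \<in> jump_times f s t"
    show "y = u"
    proof (rule ccontr)
      assume "y \<noteq> u"
      then consider "y < u" | "u < y" by linarith
      then have "eventually (\<lambda>x. f x = f y) (at_left y)"
      proof cases
        case 1
        have "f x = f y" if "s < x" "x < y" for x
          using below[of x] below[of y] that 1 by simp
        then show ?thesis using y by (intro eventually_at_left_interval[of s]) (simp add: jump_times_iff)
      next
        case 2
        have "f x = f y" if "u < x" "x < y" for x
          using above[of x] above[of y] that 2 y by (simp add: jump_times_iff)
        then show ?thesis by (intro eventually_at_left_interval[OF 2])
      qed
      then show False using y by (simp add: jump_times_iff)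
    qed
  next
    assume "y = u"
    moreover have "\<not> eventually (\<lambda>x. f x = f u) (at_left u)"
    proof
      assume "eventually (\<lambda>x. f x = f u) (at_left u)"
      moreover have "eventually (\<lambda>x. f x = f s) (at_left u)"
        by (rule eventually_at_left_interval[OF su], rule below) auto
      ultimately have "eventually (\<lambda>x. False) (at_left u)"
        by eventually_elim (use fu R1 in simp)
      then show False by (simp add: trivial_limit_at_left_real)
    qed
    ultimately show "y \<in> jump_times f s t" using su u by (simp add: jump_times_iff)
  qed
  then have "jump_times f s t = {u}" by auto
  then show "exactly_one_jump_to v f s t" using fu by (auto simp: exactly_one_jump_to_def)
qed

lemma more_than_one_jump_iff:
  "more_than_one_jump f s t \<longleftrightarrow> jump_times f s t \<noteq> {} \<and> (\<forall>v. \<not> exactly_one_jump_to v f s t)"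
proof -
  have "(\<forall>v. \<not> exactly_one_jump_to v f s t) \<longleftrightarrow> (\<forall>u. jump_times f s t \<noteq> {u})"
    by (auto simp: exactly_one_jump_to_def)
  moreover have "(\<exists>u\<in>S. \<exists>u'\<in>S. u \<noteq> u') \<longleftrightarrow> S \<noteq> {} \<and> (\<forall>u. S \<noteq> {u})" for S :: "real set"
    by blast
  ultimately show ?thesis by (simp add: more_than_one_jump_def)
qed

section \<open>Joint measurability of right-continuous processes\<close>

lemma right_continuous_approx:
  fixes f :: "real \<Rightarrow> int"
  assumes "eventually (\<lambda>u. f u = f s) (at_right s)"
  shows "(\<lambda>m. real_of_int (f ((of_int \<lfloor>real (Suc m) * s\<rfloor> + 1) / real (Suc m)))) \<longlonglongrightarrow> real_of_int (f s)"
proof (rule tendsto_eventually)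
  obtain b where b: "s < b" "\<And>z. s < z \<Longrightarrow> z < b \<Longrightarrow> f z = f s"
    using assms by (auto simp: eventually_at_right_field)
  have "(\<lambda>m. 1 / real (Suc m)) \<longlonglongrightarrow> 0"
    by (rule LIMSEQ_Suc[OF lim_1_over_n])
  then have "eventually (\<lambda>m. 1 / real (Suc m) < b - s) sequentially"
    using b by (intro order_tendstoD) auto
  then show "eventually (\<lambda>m. real_of_int (f ((of_int \<lfloor>real (Suc m) * s\<rfloor> + 1) / real (Suc m))) = real_of_int (f s)) sequentially"
  proof eventually_elim
    case (elim m)
    let ?k = "of_int \<lfloor>real (Suc m) * s\<rfloor> :: real"
    \<comment> \<open>The \<open>+ 1\<close> puts the grid point strictly to the right of
      \<open>s\<close>, where the hypothesis applies, at distance at most the mesh.\<close>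
    have "s < (?k + 1) / real (Suc m)"
      using real_of_int_floor_add_one_gt[of "real (Suc m) * s"] by (simp add: pos_less_divide_eq mult.commute)
    moreover have "(?k + 1) / real (Suc m) \<le> (real (Suc m) * s + 1) / real (Suc m)"
      by (intro divide_right_mono) (auto intro: of_int_floor_le)
    moreover have "(real (Suc m) * s + 1) / real (Suc m) = s + 1 / real (Suc m)"
      by (simp add: add_divide_distrib)
    ultimately show ?case using b(2) elim by simp
  qed
qed

text \<open>Moving the time to the next grid point gives a process that depends on time only through
  an integer index, hence is jointly measurable; refining the grid converges pointwise by
  right-continuity. This makes time integrals, and so local times, measurable in
  \<open>\<omega>\<close>.\<close>

lemma right_continuous_joint_measurable:
  fixes Y :: "real \<Rightarrow> 'a \<Rightarrow> int"
  assumes Y: "\<And>s. Y s \<in> measurable N (count_space UNIV)"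
    and rc: "\<And>s \<omega>. \<omega> \<in> space N \<Longrightarrow> eventually (\<lambda>u. Y u \<omega> = Y s \<omega>) (at_right s)"
  shows "(\<lambda>z. real_of_int (Y (fst z) (snd z))) \<in> borel_measurable (borel \<Otimes>\<^sub>M N)"
proof (rule borel_measurable_LIMSEQ_real)
  fix z :: "real \<times> 'a" assume "z \<in> space (borel \<Otimes>\<^sub>M N)"
  then have "snd z \<in> space N" by (auto simp: space_pair_measure)
  from right_continuous_approx[OF rc[OF this, of "fst z"]]
  show "(\<lambda>m. real_of_int (Y ((of_int \<lfloor>real (Suc m) * fst z\<rfloor> + 1) / real (Suc m)) (snd z)))
    \<longlonglongrightarrow> real_of_int (Y (fst z) (snd z))" .
next
  fix m
  have *: "(\<lambda>z :: real \<times> 'a. real_of_int (Y s (snd z))) \<in> borel_measurable (borel \<Otimes>\<^sub>M N)" for s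
    using Y[of s] by (intro measurable_compose[OF measurable_snd] measurable_compose[OF Y]) auto
  show "(\<lambda>z :: real \<times> 'a. real_of_int (Y ((of_int \<lfloor>real (Suc m) * fst z\<rfloor> + 1) / real (Suc m)) (snd z)))
    \<in> borel_measurable (borel \<Otimes>\<^sub>M N)"
    by (rule measurable_compose_countable[where g = "\<lambda>z. \<lfloor>real (Suc m) * fst z\<rfloor>" and
          f = "\<lambda>i z. real_of_int (Y ((of_int i + 1) / real (Suc m)) (snd z))"]) 
       (use * in \<open>measurable\<close>)
qed

text \<open>Clamping time to \<open>[0, t]\<close> gives a function right-continuous on the whole
  real line that reads the path only up to time \<open>t\<close>. Joint measurability can then be
  applied with the sigma-algebra of time \<open>t\<close>.\<close>

lemma cadlag_clamped:
  assumes "cadlag f" "0 \<le> t"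
  shows "eventually (\<lambda>u. f (min t (max 0 u)) = f (min t (max 0 s))) (at_right s)"
proof -
  consider "s < 0" | "0 \<le> s" "s < t" | "t \<le> s" using assms by linarith
  then show ?thesis
  proof cases
    case 1
    then show ?thesis by (auto simp: eventually_at_right_field intro!: exI[of _ 0])
  next
    case 2
    obtain b where b: "s < b" "\<And>z. s < z \<Longrightarrow> z < b \<Longrightarrow> f z = f s"
      using cadlag_at_right[OF assms(1) 2(1)] by (auto simp: eventually_at_right_field)
    show ?thesis
      unfolding eventually_at_right_field using 2 b by (intro exI[of _ "min b t"]) auto
  next
    case 3
    then show ?thesis using assms by (auto simp: eventually_at_right_field min_def intro!: exI[of _ "s + 1"])
  qed
qed

lemma cadlag_indicator_set_integrable:
  assumes "cadlag f" "0 \<le> a"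
  shows "set_integrable lborel {a..b} (\<lambda>s. indicat_real {v} (f s))"
proof (cases "a \<le> b")
  case True
  let ?g = "\<lambda>s. f (min b (max 0 s))"
  \<comment> \<open>A single path is viewed as a process over a one-point space, so that joint
    measurability becomes measurability in time.\<close>
  have "(\<lambda>z. real_of_int (?g (fst z))) \<in> borel_measurable (borel \<Otimes>\<^sub>M count_space (UNIV :: unit set))"
    using right_continuous_joint_measurable[of "\<lambda>s _. ?g s" "count_space (UNIV :: unit set)"]
      cadlag_clamped[OF assms(1), of b] True assms by simp
  then have "(\<lambda>s. real_of_int (?g (fst (s, ())))) \<in> borel_measurable borel"
    by (rule measurable_compose[rotated]) auto
  then have "(\<lambda>s. indicat_real {real_of_int v} (real_of_int (?g s))) \<in> borel_measurable borel"
    by (intro measurable_compose[OF _ borel_measurable_indicator]) auto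
  then have m: "(\<lambda>s. indicat_real {v} (?g s)) \<in> borel_measurable borel"
    by (simp add: indicator_def)
  have "set_integrable lborel {a..b} (\<lambda>s. indicat_real {v} (?g s))"
    unfolding set_integrable_def
    by (rule Bochner_Integration.integrable_bound[OF integrable_real_indicator[of "{a..b}"]])
       (use m True in \<open>auto simp: indicator_def\<close>)
  then show ?thesis
    by (rule set_integrable_cong[THEN iffD1, rotated 3]) (use assms in \<open>auto simp: max_def min_def\<close>)
next
  case False
  then show ?thesis by (simp add: set_integrable_def)
qed

lemma cadlag_indicator_integrable:
  assumes "cadlag f" "0 \<le> a"
  shows "(\<lambda>s. indicat_real {v} (f s)) integrable_on {a..b}"
  using set_borel_integral_eq_integral(1)[OF cadlag_indicator_set_integrable[OF assms]] .

section \<open>Growth of local times\<close>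

lemma local_time_0: "local_time f v 0 = 1"
  by (simp add: local_time_def)

lemma local_time_increment:
  assumes "cadlag f" "0 \<le> s" "s \<le> t"
  shows "local_time f v t - local_time f v s = integral {s..t} (\<lambda>s. indicat_real {v} (f s))"
  unfolding local_time_def
  using Henstock_Kurzweil_Integration.integral_combine[of 0 s t "\<lambda>s. indicat_real {v} (f s)"]
    cadlag_indicator_integrable[OF assms(1), of 0] assms by simp

lemma local_time_increment_bounds:
  assumes "cadlag f" "0 \<le> s" "s \<le> t"
  shows "local_time f v s \<le> local_time f v t" "local_time f v t \<le> local_time f v s + (t - s)"
proof -
  have "0 \<le> integral {s..t} (\<lambda>s. indicat_real {v} (f s))"
    by (intro integral_nonneg cadlag_indicator_integrable assms) auto
  then show "local_time f v s \<le> local_time f v t"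
    using local_time_increment[OF assms, of v] by simp
  have "integral {s..t} (\<lambda>s. indicat_real {v} (f s)) \<le> integral {s..t} (\<lambda>s. 1)"
    by (intro integral_le cadlag_indicator_integrable assms) (auto simp: indicator_def)
  then show "local_time f v t \<le> local_time f v s + (t - s)"
    using local_time_increment[OF assms, of v] assms by simp
qed

lemma local_time_ge_1: "cadlag f \<Longrightarrow> 0 \<le> t \<Longrightarrow> 1 \<le> local_time f v t"
  using local_time_increment_bounds(1)[of f 0 t v] by (simp add: local_time_0)

lemma local_time_le: "cadlag f \<Longrightarrow> 0 \<le> t \<Longrightarrow> local_time f v t \<le> 1 + t"
  using local_time_increment_bounds(2)[of f 0 t v] by (simp add: local_time_0)

lemma local_time_away:
  assumes "cadlag f" "0 \<le> s" "s \<le> t" "\<And>x. s \<le> x \<Longrightarrow> x \<le> t \<Longrightarrow> f x \<noteq> v"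
  shows "local_time f v t = local_time f v s"
proof -
  have "integral {s..t} (\<lambda>s. indicat_real {v} (f s)) = integral {s..t} (\<lambda>s. 0)"
    using assms by (intro integral_cong) (auto simp: indicator_def)
  then show ?thesis using local_time_increment[OF assms(1-3), of v] by simp
qed

lemma local_time_staying:
  assumes "cadlag f" "0 \<le> s" "s \<le> t" "\<And>x. s \<le> x \<Longrightarrow> x \<le> t \<Longrightarrow> f x = v"
  shows "local_time f v t = local_time f v s + (t - s)"
proof -
  have "integral {s..t} (\<lambda>s. indicat_real {v} (f s)) = integral {s..t} (\<lambda>s. 1)"
    using assms by (intro integral_cong) (auto simp: indicator_def)
  then show ?thesis using local_time_increment[OF assms(1-3), of v] assms by simp
qed

section \<open>The value of an edge along a path: change over a short time step\<close>

context reinforcement_weight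
begin

text \<open>
  Here \<open>h\<close> is the mesh of the time grid. As \<open>1/w\<close> need not be continuous, \<open>h/w a - (W (a + h) - W a)\<close> is
  not \<open>o(h)\<close> uniformly in \<open>a\<close>; the correction \<open>h/w a\<close> absorbs this defect exactly.
\<close>

definition edge_value :: "(real \<Rightarrow> int) \<Rightarrow> int \<Rightarrow> real \<Rightarrow> real \<Rightarrow> real" where
  "edge_value f x h t =
     W (local_time f (x + 1) t) - W (local_time f x t)
     + (if x < f t then right_potential else left_potential) (local_time f x t) (local_time f (x + 1) t)
     + h / w (local_time f x t)"

text \<open>The leading part of the change of \<open>edge_value\<close> in a jump from
  \<open>y\<close> to \<open>v\<close>. The local times are frozen at \<open>t\<close>, which makes
  it measurable at time \<open>t\<close>. After a crossing to the left the new left potential is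
  replaced by its upper bound 0.\<close>

definition jump_gain :: "(real \<Rightarrow> int) \<Rightarrow> int \<Rightarrow> real \<Rightarrow> int \<Rightarrow> int \<Rightarrow> real" where
  "jump_gain f x t y v =
     (if y = x \<and> v = x + 1 then
        right_potential (local_time f x t) (local_time f (x + 1) t)
        - left_potential (local_time f x t) (local_time f (x + 1) t)
      else if y = x + 1 \<and> v = x then - right_potential (local_time f x t) (local_time f (x + 1) t)
      else 0)"

text \<open>Rate of a crossing of the edge times its gain: the density of the compensator of the
  jump part of \<open>edge_value\<close>.\<close>

definition edge_drift :: "(real \<Rightarrow> int) \<Rightarrow> int \<Rightarrow> real \<Rightarrow> real" where
  "edge_drift f x t =
     (if f t = x then w (local_time f (x + 1) t) * jump_gain f x t x (x + 1)
      else if f t = x + 1 then w (local_time f x t) * jump_gain f x t (x + 1) x else 0)"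

lemma correction_decreasing:
  assumes "1 \<le> a" "a \<le> a'" "0 \<le> h" shows "h / w a' \<le> h / w a"
  using mult_left_mono[OF inverse_w_antimono[OF assms(1,2)] assms(3)] by simp

text \<open>Without a jump only the local time of the current site grows, so at an end of the edge
  this is \<open>left_generator\<close> or \<open>right_generator\<close>, and elsewhere nothing
  changes.\<close>

lemma edge_value_no_jump:
  assumes f: "cadlag f" and t: "0 \<le> t" and h: "0 < h" "h \<le> 1" and J: "jump_times f t (t + h) = {}"
  shows "edge_value f x h (t + h) - edge_value f x h t \<le> - (h * edge_drift f x t)"
proof -
  define a b where "a = local_time f x t" and "b = local_time f (x + 1) t"
  have ab: "1 \<le> a" "1 \<le> b" using local_time_ge_1[OF f t] by (auto simp: a_def b_def)
  have c: "f u = f t" if "t \<le> u" "u \<le> t + h" for u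
    using constant_without_jumps[OF f t J, of u] that by simp
  have L: "local_time f y (t + h) = (if f t = y then local_time f y t + h else local_time f y t)" for y
  proof (cases "f t = y")
    case True
    have "f s = y" if "t \<le> s" "s \<le> t + h" for s using c[OF that] True by simp
    then show ?thesis using local_time_staying[OF f t, of "t + h" y] True h by simp
  next
    case False
    have "f s \<noteq> y" if "t \<le> s" "s \<le> t + h" for s using c[OF that] False by simp
    then show ?thesis using local_time_away[OF f t, of "t + h" y] False h by simp
  qed
  have ft: "f (t + h) = f t" using c[of "t + h"] h by simp
  consider "f t = x" | "f t = x + 1" | "f t \<noteq> x" "f t \<noteq> x + 1" by blast
  then show ?thesis
  proof cases
    case 1
    then show ?thesis
      using left_generator[of a b h] ab h
      by (simp add: edge_value_def edge_drift_def jump_gain_def L ft right_diff_distrib flip: a_def b_def)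
  next
    case 2
    then show ?thesis
      using right_generator[of a b h] ab h
      by (simp add: edge_value_def edge_drift_def jump_gain_def L ft flip: a_def b_def)
  next
    case 3
    then show ?thesis by (simp add: edge_value_def edge_drift_def L ft)
  qed
qed

lemma edge_value_one_jump:
  assumes f: "cadlag f" and t: "0 \<le> t" and h: "0 < h" and J: "exactly_one_jump_to v f t (t + h)"
    and v: "\<bar>v - f t\<bar> = 1"
  shows "edge_value f x h (t + h) - edge_value f x h t
    \<le> (if f t \<in> {x - 1..x + 2} then jump_gain f x t (f t) v + 2 * h else 0)"
proof -
  define a b a' b' where "a = local_time f x t" and "b = local_time f (x + 1) t"
    and "a' = local_time f x (t + h)" and "b' = local_time f (x + 1) (t + h)"
  have ab: "1 \<le> a" "1 \<le> b" "a \<le> a'" "b \<le> b'" "a' \<le> a + h" "b' \<le> b + h"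
    using local_time_ge_1[OF f t] local_time_increment_bounds[OF f t, of "t + h"] h
    by (auto simp: a_def b_def a'_def b'_def)
  have ab': "1 \<le> a'" "1 \<le> b'" using ab by auto
  obtain u where u: "t < u" "u \<le> t + h" "\<And>x. t \<le> x \<Longrightarrow> x < u \<Longrightarrow> f x = f t"
    "\<And>x. u \<le> x \<Longrightarrow> x \<le> t + h \<Longrightarrow> f x = v" "v \<noteq> f t"
    by (rule exactly_one_jump_path[OF f t J], rule that)
  have fv: "f (t + h) = v" using u(2) u(4)[of "t + h"] by simp
  have away: "local_time f y (t + h) = local_time f y t" if "y \<noteq> f t" "y \<noteq> v" for y
  proof (rule local_time_away[OF f t])
    fix s assume "t \<le> s" "s \<le> t + h"
    then show "f s \<noteq> y" using u(3)[of s] u(4)[of s] that by (cases "s < u") auto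
  qed (use h in auto)
  have Wb: "W b' - W b \<le> h" using W_lipschitz[of b b'] ab by simp
  have Wa: "W a \<le> W a'" using W_mono[of a a'] ab by simp
  have corr: "h / w a' \<le> h / w a" using ab h by (intro correction_decreasing) auto
  have R: "right_potential a' b' - right_potential a b \<le> h"
    using right_potential_increment[of a a' b b'] ab by simp
  have Lh: "left_potential a' b - left_potential a b \<le> h"
  proof -
    have "eta / 2 * max 0 (2 - a) * (a' - a) \<le> 1 * h"
      using ab eta_pos eta_le_1 h mult_mono[of "eta / 2" 1 "max 0 (2 - a)" 1] by (intro mult_mono) auto
    then show ?thesis using left_potential_increment[of a a' b] ab h by (simp split: if_splits)
  qed
  note expand = edge_value_def jump_gain_def fv a_def[symmetric] b_def[symmetric]
      a'_def[symmetric] b'_def[symmetric]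
  have v': "v = f t + 1 \<or> v = f t - 1" using v by linarith
  consider (up) "f t = x" "v = x + 1" | (down) "f t = x + 1" "v = x" | (l) "f t = x" "v = x - 1"
    | (r) "f t = x + 1" "v = x + 2" | (fr) "f t > x + 1" | (fl) "f t < x"
    using v' by force
  then show ?thesis
  proof cases
    case up
    then show ?thesis using Wb Wa corr R by (simp add: expand)
  next
    case down
    then show ?thesis using Wb Wa corr left_potential_nonpos[of a' b'] h by (simp add: expand)
  next
    case l
    then have "b' = b" using away[of "x + 1"] by (simp add: b_def b'_def)
    then show ?thesis using l Wa corr Lh h by (simp add: expand)
  next
    case r
    then show ?thesis using Wb Wa corr R by (simp add: expand)
  next
    case fr
    then have a: "a' = a" using away[of x] v' by (auto simp: a_def a'_def)
    show ?thesis
    proof (cases "f t = x + 2")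
      case True
      then show ?thesis using fr v' Wb corr R h by (auto simp add: expand a)
    next
      case False
      then have "b' = b" using fr away[of "x + 1"] v' by (auto simp: b_def b'_def)
      then show ?thesis using False fr v' by (auto simp add: expand a)
    qed
  next
    case fl
    then have b: "b' = b" using away[of "x + 1"] v' by (auto simp: b_def b'_def)
    show ?thesis
    proof (cases "f t = x - 1")
      case True
      then show ?thesis using fl v' Wa corr Lh h by (auto simp add: expand b)
    next
      case False
      then have "a' = a" using fl away[of x] v' by (auto simp: a_def a'_def)
      then show ?thesis using False fl v' by (auto simp add: expand b)
    qed
  qed
qed

text \<open>Crude bound for several jumps, whose probability is \<open>o(h)\<close>: at most 1 from
  \<open>W\<close>, at most 1 from the new potential and at most 1 from dropping the old
  one.\<close>

lemma edge_value_increment: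
  assumes f: "cadlag f" and t: "0 \<le> t" and h: "0 < h" "h \<le> 1"
  shows "edge_value f x h (t + h) - edge_value f x h t \<le> 3"
proof -
  define a b a' b' where "a = local_time f x t" and "b = local_time f (x + 1) t"
    and "a' = local_time f x (t + h)" and "b' = local_time f (x + 1) (t + h)"
  have ab: "1 \<le> a" "1 \<le> b" "a \<le> a'" "b \<le> b'" "a' \<le> a + h" "b' \<le> b + h"
    using local_time_ge_1[OF f t] local_time_increment_bounds[OF f t, of "t + h"] h
    by (auto simp: a_def b_def a'_def b'_def)
  have "W b' - W b \<le> h" using W_lipschitz[of b b'] ab by simp
  moreover have "W a \<le> W a'" using W_mono[of a a'] ab by simp
  moreover have "h / w a' \<le> h / w a" using ab h by (intro correction_decreasing) auto
  moreover have "(if x < f (t + h) then right_potential else left_potential) a' b' \<le> 1"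
    using right_potential_le_1[of a' b'] left_potential_nonpos[of a' b'] ab by auto
  moreover have "- 1 \<le> (if x < f t then right_potential else left_potential) a b"
    using right_potential_nonneg[of a b] left_potential_ge[of a b] eta_le_1 ab by auto
  ultimately show ?thesis
    using h unfolding edge_value_def a_def[symmetric] b_def[symmetric] a'_def[symmetric] b'_def[symmetric]
    by linarith
qed

end

section \<open>Measurability with respect to the natural filtration\<close>

context vrjp
begin

abbreviation F :: "real \<Rightarrow> 'a measure" where
  "F t \<equiv> natural_filtration M X t"

abbreviation path :: "'a \<Rightarrow> real \<Rightarrow> int" where
  "path \<omega> \<equiv> \<lambda>s. X s \<omega>"

lemma space_F: "space (F t) = space M"
  by (simp add: natural_filtration_def space_measure_of_conv)

lemma sets_F: "sets (F t) = sigma_sets (space M) {X s -` A \<inter> space M |s A. s \<in> {0..t}}"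
  unfolding natural_filtration_def by (rule sets_measure_of) auto

lemma subalgebra_F: "subalgebra M (F t)"
proof -
  have "X s -` A \<inter> space M \<in> sets M" if "0 \<le> s" for s A
    using measurable_sets[OF measurable_X[OF that], of A] by simp
  then have "sigma_sets (space M) {X s -` A \<inter> space M |s A. s \<in> {0..t}} \<subseteq> sets M"
    by (intro sets.sigma_sets_subset) auto
  then show ?thesis by (simp add: subalgebra_def space_F sets_F)
qed

lemma sigma_finite_subalgebra_F: "sigma_finite_subalgebra M (F t)"
  by (intro finite_measure_subalgebra_is_sigma_finite finite_measure_subalgebra.intro
      finite_measure_subalgebra_axioms.intro subalgebra_F) unfold_locales

lemma measurable_X_F:
  assumes "0 \<le> s" "s \<le> t"
  shows "X s \<in> measurable (F t) (count_space UNIV)"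
proof (rule measurableI)
  fix A :: "int set"
  show "X s -` A \<inter> space (F t) \<in> sets (F t)"
    unfolding space_F sets_F using assms by (intro sigma_sets.Basic) auto
qed simp

text \<open>The local time is the integral of a jointly measurable indicator; using the clamped
  process, which reads only times in \<open>[0, t]\<close>, gives adaptedness and not merely
  measurability.\<close>

lemma local_time_measurable_F:
  assumes t: "0 \<le> t"
  shows "(\<lambda>\<omega>. local_time (path \<omega>) v t) \<in> borel_measurable (F t)"
proof -
  let ?Y = "\<lambda>s \<omega>. X (min t (max 0 s)) \<omega>"
  have J: "(\<lambda>z. real_of_int (?Y (fst z) (snd z))) \<in> borel_measurable (borel \<Otimes>\<^sub>M F t)"
    using t cadlag_paths cadlag_clamped[OF _ t]
    by (intro right_continuous_joint_measurable measurable_X_F) (auto simp: space_F)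
  have "(\<lambda>p. (snd p, fst p)) \<in> measurable (F t \<Otimes>\<^sub>M lborel) (borel \<Otimes>\<^sub>M F t)"
    by measurable
  from measurable_compose[OF this J]
  have "(\<lambda>p. real_of_int (?Y (snd p) (fst p))) \<in> borel_measurable (F t \<Otimes>\<^sub>M lborel)"
    by simp
  then have "(\<lambda>p. indicat_real {real_of_int v} (real_of_int (?Y (snd p) (fst p)))) \<in> borel_measurable (F t \<Otimes>\<^sub>M lborel)"
    by (intro measurable_compose[OF _ borel_measurable_indicator]) auto
  then have [measurable]: "(\<lambda>p. indicat_real {v} (?Y (snd p) (fst p))) \<in> borel_measurable (F t \<Otimes>\<^sub>M lborel)"
    by (simp add: indicator_def)
  have "(\<lambda>p. indicat_real {0..t} (snd p) * indicat_real {v} (?Y (snd p) (fst p))) \<in> borel_measurable (F t \<Otimes>\<^sub>M lborel)"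
    by measurable
  then have meas: "(\<lambda>\<omega>. LINT s|lborel. indicat_real {0..t} s * indicat_real {v} (?Y s \<omega>)) \<in> borel_measurable (F t)"
    by (intro lborel.borel_measurable_lebesgue_integral) (simp add: split_beta')
  have eq: "local_time (path \<omega>) v t = 1 + (LINT s|lborel. indicat_real {0..t} s * indicat_real {v} (?Y s \<omega>))"
    if "\<omega> \<in> space (F t)" for \<omega>
  proof -
    have "cadlag (path \<omega>)" using that cadlag_paths by (simp add: space_F)
    note set_borel_integral_eq_integral(2)[OF cadlag_indicator_set_integrable[OF this, of 0 t v]]
    moreover have "(\<lambda>s. indicat_real {0..t} s * indicat_real {v} (?Y s \<omega>)) =
        (\<lambda>s. indicat_real {0..t} s *\<^sub>R indicat_real {v} (X s \<omega>))"
      by (auto simp: fun_eq_iff indicator_def min_def max_def)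
    ultimately show ?thesis by (simp add: local_time_def set_lebesgue_integral_def)
  qed
  show ?thesis
    by (subst measurable_cong[OF eq]) (use meas in simp_all)
qed

lemma local_time_measurable:
  "0 \<le> t \<Longrightarrow> (\<lambda>\<omega>. local_time (path \<omega>) v t) \<in> borel_measurable M"
  using local_time_measurable_F subalgebra_F measurable_from_subalg by blast

text \<open>The clamp at 0 makes the index admissible for every rational, so statements quantified
  over all rationals are measurable; at the rationals after some \<open>s \<ge> 0\<close> it changes
  nothing.\<close>

lemma measurable_X_rat [measurable]: "X (max 0 (of_rat q)) \<in> measurable M (count_space UNIV)"
  by (rule measurable_X) simp

lemma no_jump_measurable:
  assumes s: "0 \<le> s" "s < t"
  shows "{\<omega> \<in> space M. jump_times (path \<omega>) s t = {}} \<in> sets M"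
proof -
  have [measurable]: "X s \<in> measurable M (count_space UNIV)" "X t \<in> measurable M (count_space UNIV)"
    using s by (auto intro: measurable_X)
  have max: "max 0 (of_rat q) = (of_rat q :: real)" if "s < of_rat q" for q
    using s that by simp
  have eq: "jump_times (path \<omega>) s t = {} \<longleftrightarrow> X t \<omega> = X s \<omega> \<and>
      (\<forall>q::rat. s < of_rat q \<and> of_rat q < t \<longrightarrow> X (max 0 (of_rat q)) \<omega> = X s \<omega>)" if "\<omega> \<in> space M" for \<omega>
    unfolding no_jump_iff[OF cadlag_paths[OF that] s] Rats_def
    by (simp add: max cong: conj_cong imp_cong)
  have "{\<omega> \<in> space M. X t \<omega> = X s \<omega> \<and>
      (\<forall>q::rat. s < of_rat q \<and> of_rat q < t \<longrightarrow> X (max 0 (of_rat q)) \<omega> = X s \<omega>)} \<in> sets M"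
    by measurable
  then show ?thesis using eq by (simp cong: conj_cong)
qed

lemma one_jump_measurable:
  assumes s: "0 \<le> s" "s < t"
  shows "{\<omega> \<in> space M. exactly_one_jump_to v (path \<omega>) s t} \<in> sets M"
proof -
  have [measurable]: "X s \<in> measurable M (count_space UNIV)" "X t \<in> measurable M (count_space UNIV)"
    using s by (auto intro: measurable_X)
  let ?X = "\<lambda>q::rat. X (max 0 (of_rat q))"
  have max: "max 0 (of_rat q) = (of_rat q :: real)" if "s < of_rat q" for q
    using s that by simp
  have eq: "exactly_one_jump_to v (path \<omega>) s t \<longleftrightarrow> X s \<omega> \<noteq> v \<and> X t \<omega> = v \<and>
      (\<forall>q::rat. s < of_rat q \<and> of_rat q < t \<longrightarrow> ?X q \<omega> = X s \<omega> \<or> ?X q \<omega> = v) \<and>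
      (\<forall>q::rat. \<forall>q'::rat. s < of_rat q \<and> s < of_rat q' \<and> of_rat q < (of_rat q' :: real) \<and> of_rat q' < t
         \<longrightarrow> ?X q \<omega> = v \<longrightarrow> ?X q' \<omega> = v)"
    (is "_ = ?R \<omega>") if "\<omega> \<in> space M" for \<omega>
    unfolding exactly_one_jump_iff[OF cadlag_paths[OF that] s] Rats_def
    by (simp add: max cong: conj_cong imp_cong)
  have "{\<omega> \<in> space M. ?R \<omega>} \<in> sets M" by measurable
  then show ?thesis using eq by (simp cong: conj_cong)
qed

lemma more_than_one_jump_measurable:
  assumes s: "0 \<le> s" "s < t"
  shows "{\<omega> \<in> space M. more_than_one_jump (path \<omega>) s t} \<in> sets M"
proof -
  have "{\<omega> \<in> space M. more_than_one_jump (path \<omega>) s t} =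
     (space M - {\<omega> \<in> space M. jump_times (path \<omega>) s t = {}})
     - (\<Union>v. {\<omega> \<in> space M. exactly_one_jump_to v (path \<omega>) s t})"
    by (auto simp: more_than_one_jump_iff)
  also have "\<dots> \<in> sets M"
    using no_jump_measurable[OF s] one_jump_measurable[OF s] by (intro sets.Diff sets.countable_UN) auto
  finally show ?thesis .
qed

abbreviation one_jump :: "int \<Rightarrow> real \<Rightarrow> real \<Rightarrow> 'a \<Rightarrow> real" where
  "one_jump v t h \<equiv> indicat_real {\<omega> \<in> space M. exactly_one_jump_to v (path \<omega>) t (t + h)}"

abbreviation many_jumps :: "real \<Rightarrow> real \<Rightarrow> 'a \<Rightarrow> real" where
  "many_jumps t h \<equiv> indicat_real {\<omega> \<in> space M. more_than_one_jump (path \<omega>) t (t + h)}"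

lemma bounded_integrable:
  assumes "f \<in> borel_measurable M" "\<And>\<omega>. \<omega> \<in> space M \<Longrightarrow> \<bar>f \<omega>\<bar> \<le> C"
  shows "integrable M (f :: 'a \<Rightarrow> real)"
  using assms by (intro integrable_const_bound[of _ C]) auto

end

section \<open>Expected change of the value of an edge in one time step\<close>

locale vrjp_monotone = vrjp M w X + reinforcement_weight w
  for M :: "'a measure" and w :: "real \<Rightarrow> real" and X :: "real \<Rightarrow> 'a \<Rightarrow> int"
begin

lemma w_local_time_measurable:
  assumes "0 \<le> t"
  shows "(\<lambda>\<omega>. w (local_time (path \<omega>) v t)) \<in> borel_measurable (F t)"
proof -
  \<comment> \<open>Monotonicity of \<open>w\<close> is available on
    \<open>[1, \<infinity>)\<close>; local times stay there, so extending \<open>w\<close> by a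
    constant below 1 does not alter the composition.\<close>
  have "(\<lambda>x. w (max 1 x)) \<in> borel_measurable borel"
    by (intro borel_measurable_mono monoI w_mono) auto
  from measurable_compose[OF local_time_measurable_F[OF assms, of v] this]
  show ?thesis
    by (rule measurable_cong[THEN iffD1, rotated])
       (use local_time_ge_1[OF cadlag_paths assms] in \<open>simp add: space_F max_absorb2\<close>)
qed

lemma w_local_time_bounds:
  assumes "\<omega> \<in> space M" "0 \<le> t" "t \<le> T"
  shows "1 \<le> w (local_time (path \<omega>) v t)" "w (local_time (path \<omega>) v t) \<le> w (1 + T)"
  using local_time_ge_1[OF cadlag_paths[OF assms(1)] assms(2), of v]
    local_time_le[OF cadlag_paths[OF assms(1)] assms(2), of v] assms
  by (auto intro!: w_ge_1 w_mono)

text \<open>The factor measurable at time \<open>t\<close> passes through the conditional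
  expectation, so the indicator of the jump may be replaced by its conditional probability and then
  by rate times \<open>h\<close>. The rate condition speaks only of neighbours \<open>v\<close> of
  the current site, which is why the indicator of \<open>X t = y\<close> is carried along.\<close>

lemma expectation_one_jump:
  assumes t: "0 \<le> t" "0 < h"
    and r: "\<And>v. AE \<omega> in M. \<bar>v - X t \<omega>\<bar> = 1 \<longrightarrow>
         \<bar>cond_probability M (F t) (\<lambda>\<omega>'. exactly_one_jump_to v (path \<omega>') t (t + h)) \<omega>
            - w (local_time (path \<omega>) v t) * h\<bar> \<le> r"
    and G: "G \<in> borel_measurable (F t)" "\<And>\<omega>. \<omega> \<in> space M \<Longrightarrow> \<bar>G \<omega>\<bar> \<le> C"
    and v: "\<bar>v - y\<bar> = 1"
  shows "(LINT \<omega>|M. G \<omega> * indicat_real {y} (X t \<omega>) * one_jump v t h \<omega>)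
    \<le> (LINT \<omega>|M. G \<omega> * indicat_real {y} (X t \<omega>) * (w (local_time (path \<omega>) v t) * h)) + C * \<bar>r\<bar>"
proof -
  interpret FS: sigma_finite_subalgebra M "F t" by (rule sigma_finite_subalgebra_F)
  let ?f = "\<lambda>\<omega>. G \<omega> * indicat_real {y} (X t \<omega>)"
  let ?p = "cond_probability M (F t) (\<lambda>\<omega>'. exactly_one_jump_to v (path \<omega>') t (t + h))"
  have C: "0 \<le> C" using G(2) not_empty by fastforce
  have XF [measurable]: "X t \<in> measurable (F t) (count_space UNIV)"
    using t by (intro measurable_X_F) auto
  have [measurable]: "(\<lambda>\<omega>. indicat_real {y} (X t \<omega>)) \<in> borel_measurable (F t)"
    by (rule measurable_compose[OF XF]) simp
  note G(1) [measurable]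
  have fF [measurable]: "?f \<in> borel_measurable (F t)" by measurable
  have fM [measurable]: "?f \<in> borel_measurable M"
    using measurable_from_subalg[OF subalgebra_F fF] .
  have JM [measurable]: "one_jump v t h \<in> borel_measurable M"
    using one_jump_measurable[of t "t + h" v] t by (intro borel_measurable_indicator) auto
  have wM [measurable]: "(\<lambda>\<omega>. w (local_time (path \<omega>) v t)) \<in> borel_measurable M"
    using measurable_from_subalg[OF subalgebra_F w_local_time_measurable] t by auto
  have fb: "\<bar>?f \<omega>\<bar> \<le> C" if "\<omega> \<in> space M" for \<omega>
    using G(2)[OF that] C by (auto simp: indicator_def)
  have int: "integrable M (\<lambda>\<omega>. ?f \<omega> * one_jump v t h \<omega>)"
    by (rule bounded_integrable[of _ C], intro borel_measurable_times fM JM) (use fb C in \<open>auto simp: indicator_def\<close>)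
  have intw: "integrable M (\<lambda>\<omega>. ?f \<omega> * (w (local_time (path \<omega>) v t) * h))"
  proof (rule bounded_integrable[of _ "C * (w (1 + t) * h)"])
    fix \<omega> assume "\<omega> \<in> space M"
    then show "\<bar>?f \<omega> * (w (local_time (path \<omega>) v t) * h)\<bar> \<le> C * (w (1 + t) * h)"
      unfolding abs_mult[of "?f \<omega>"] using w_local_time_bounds[of \<omega> t t v] t fb[of \<omega>] C by (intro mult_mono) auto
  qed measurable
  have p: "integrable M (\<lambda>\<omega>. ?f \<omega> * ?p \<omega>)" "(LINT \<omega>|M. ?f \<omega> * ?p \<omega>) = (LINT \<omega>|M. ?f \<omega> * one_jump v t h \<omega>)"
    unfolding cond_probability_def
    using FS.real_cond_exp_intg[OF int fF JM] by auto
  have "(LINT \<omega>|M. ?f \<omega> * ?p \<omega>) \<le> (LINT \<omega>|M. ?f \<omega> * (w (local_time (path \<omega>) v t) * h) + C * \<bar>r\<bar>)"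
  proof (rule integral_mono_AE[OF p(1)])
    show "AE \<omega> in M. ?f \<omega> * ?p \<omega> \<le> ?f \<omega> * (w (local_time (path \<omega>) v t) * h) + C * \<bar>r\<bar>"
      using r[of v] AE_space
    proof eventually_elim
      case (elim \<omega>)
      show ?case
      proof (cases "X t \<omega> = y")
        case True
        have "?f \<omega> * ?p \<omega> - ?f \<omega> * (w (local_time (path \<omega>) v t) * h)
            \<le> \<bar>?f \<omega>\<bar> * \<bar>?p \<omega> - w (local_time (path \<omega>) v t) * h\<bar>"
          unfolding abs_mult[symmetric] right_diff_distrib[symmetric] by (rule abs_ge_self)
        also have "\<dots> \<le> C * \<bar>r\<bar>"
          using elim v True fb[of \<omega>] C by (intro mult_mono) auto
        finally show ?thesis by simp
      qed (use C in simp)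
    qed
  qed (use intw in simp)
  also have "\<dots> = (LINT \<omega>|M. ?f \<omega> * (w (local_time (path \<omega>) v t) * h)) + C * \<bar>r\<bar>"
    using intw by (simp add: prob_space)
  finally show ?thesis by (simp add: p)
qed

lemma expectation_many_jumps:
  assumes t: "0 \<le> t" "0 < h"
    and r: "AE \<omega> in M. cond_probability M (F t) (\<lambda>\<omega>'. more_than_one_jump (path \<omega>') t (t + h)) \<omega> \<le> r"
  shows "(LINT \<omega>|M. many_jumps t h \<omega>) \<le> \<bar>r\<bar>"
proof -
  interpret FS: sigma_finite_subalgebra M "F t" by (rule sigma_finite_subalgebra_F)
  let ?p = "cond_probability M (F t) (\<lambda>\<omega>'. more_than_one_jump (path \<omega>') t (t + h))"
  have JM [measurable]: "many_jumps t h \<in> borel_measurable M"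
    using more_than_one_jump_measurable[of t "t + h"] t by (intro borel_measurable_indicator) auto
  have int: "integrable M (many_jumps t h)"
    by (rule bounded_integrable[of _ 1], rule JM) (auto simp: indicator_def)
  have p: "integrable M ?p" "(LINT \<omega>|M. ?p \<omega>) = (LINT \<omega>|M. many_jumps t h \<omega>)"
    unfolding cond_probability_def using FS.real_cond_exp_int[OF int] by auto
  have "(LINT \<omega>|M. ?p \<omega>) \<le> (LINT \<omega>|M. \<bar>r\<bar>)"
    by (rule integral_mono_AE[OF p(1)]) (use r in \<open>auto elim!: eventually_mono\<close>)
  then show ?thesis by (simp add: p prob_space)
qed

lemma W_local_time_measurable:
  assumes "0 \<le> t"
  shows "(\<lambda>\<omega>. W (local_time (path \<omega>) v t)) \<in> borel_measurable (F t)"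
proof -
  have "(\<lambda>x. W (max 1 x)) \<in> borel_measurable borel"
    by (intro borel_measurable_mono monoI W_mono) auto
  from measurable_compose[OF local_time_measurable_F[OF assms, of v] this]
  show ?thesis
    by (rule measurable_cong[THEN iffD1, rotated])
       (use local_time_ge_1[OF cadlag_paths assms] in \<open>simp add: space_F max_absorb2\<close>)
qed

lemma potential_measurable:
  assumes t: "0 \<le> t"
  shows "(\<lambda>\<omega>. right_potential (local_time (path \<omega>) u t) (local_time (path \<omega>) v t)) \<in> borel_measurable (F t)"
    and "(\<lambda>\<omega>. left_potential (local_time (path \<omega>) u t) (local_time (path \<omega>) v t)) \<in> borel_measurable (F t)"
proof -
  note [measurable] = local_time_measurable_F[OF t] w_local_time_measurable[OF t]
  show "(\<lambda>\<omega>. right_potential (local_time (path \<omega>) u t) (local_time (path \<omega>) v t)) \<in> borel_measurable (F t)"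
    unfolding right_potential_def by measurable
  show "(\<lambda>\<omega>. left_potential (local_time (path \<omega>) u t) (local_time (path \<omega>) v t)) \<in> borel_measurable (F t)"
    unfolding left_potential_def by measurable
qed

lemma indicator_X_measurable:
  assumes t: "0 \<le> t"
  shows "(\<lambda>\<omega>. indicat_real A (X t \<omega>)) \<in> borel_measurable (F t)"
  by (rule measurable_compose[OF measurable_X_F[OF t order_refl]]) simp

lemma jump_gain_measurable:
  assumes t: "0 \<le> t"
  shows "(\<lambda>\<omega>. jump_gain (path \<omega>) x t y v) \<in> borel_measurable (F t)"
  using potential_measurable[OF t] unfolding jump_gain_def by (cases "y = x \<and> v = x + 1"; cases "y = x + 1 \<and> v = x") auto

lemma edge_value_measurable:
  assumes t: "0 \<le> t"
  shows "(\<lambda>\<omega>. edge_value (path \<omega>) x h t) \<in> borel_measurable (F t)"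
proof -
  note [measurable] = W_local_time_measurable[OF t] w_local_time_measurable[OF t] potential_measurable[OF t]
    indicator_X_measurable[OF t]
  have "edge_value (path \<omega>) x h t = W (local_time (path \<omega>) (x + 1) t) - W (local_time (path \<omega>) x t)
     + (indicat_real {x<..} (X t \<omega>) * right_potential (local_time (path \<omega>) x t) (local_time (path \<omega>) (x + 1) t)
     + indicat_real {..x} (X t \<omega>) * left_potential (local_time (path \<omega>) x t) (local_time (path \<omega>) (x + 1) t))
     + h / w (local_time (path \<omega>) x t)" for \<omega>
    by (simp add: edge_value_def indicator_def)
  then show ?thesis by simp
qed

lemma edge_drift_eq:
  "edge_drift (path \<omega>) x t = indicat_real {x} (X t \<omega>) * (w (local_time (path \<omega>) (x + 1) t) * jump_gain (path \<omega>) x t x (x + 1))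
     + indicat_real {x + 1} (X t \<omega>) * (w (local_time (path \<omega>) x t) * jump_gain (path \<omega>) x t (x + 1) x)"
  by (simp add: edge_drift_def indicator_def)

lemma edge_drift_measurable:
  assumes t: "0 \<le> t"
  shows "(\<lambda>\<omega>. edge_drift (path \<omega>) x t) \<in> borel_measurable (F t)"
  unfolding edge_drift_eq
  by (intro borel_measurable_add borel_measurable_times indicator_X_measurable w_local_time_measurable jump_gain_measurable t)

lemma jump_gain_bound:
  assumes "\<omega> \<in> space M" "0 \<le> t"
  shows "\<bar>jump_gain (path \<omega>) x t y v\<bar> \<le> 2"
proof -
  define a b where "a = local_time (path \<omega>) x t" and "b = local_time (path \<omega>) (x + 1) t"
  have ab: "1 \<le> a" "1 \<le> b"
    using local_time_ge_1[OF cadlag_paths[OF assms(1)] assms(2)] by (auto simp: a_def b_def)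
  show ?thesis
    unfolding jump_gain_def a_def[symmetric] b_def[symmetric]
    using right_potential_nonneg[OF ab] right_potential_le_1[OF ab] left_potential_nonpos[of a b]
      left_potential_ge[OF ab(1), of b] eta_le_1 by auto
qed

lemma edge_drift_bound:
  assumes "\<omega> \<in> space M" "0 \<le> t" "t \<le> T"
  shows "\<bar>edge_drift (path \<omega>) x t\<bar> \<le> 2 * w (1 + T)"
proof -
  have *: "\<bar>w (local_time (path \<omega>) u t) * jump_gain (path \<omega>) x t y v\<bar> \<le> w (1 + T) * 2" for u y v
    unfolding abs_mult
    using w_local_time_bounds[OF assms, of u] jump_gain_bound[OF assms(1,2), of x y v] by (intro mult_mono) auto
  have "0 \<le> w (1 + T)" using w_ge_1[of "1 + T"] assms by simp
  then show ?thesis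
    using *[of "x + 1" x "x + 1"] *[of x "x + 1" x] by (simp add: edge_drift_def)
qed

lemma edge_value_bound:
  assumes "\<omega> \<in> space M" "0 \<le> t" "t \<le> T" "0 \<le> h" "h \<le> 1"
  shows "\<bar>edge_value (path \<omega>) x h t\<bar> \<le> T + 2"
proof -
  define a b where "a = local_time (path \<omega>) x t" and "b = local_time (path \<omega>) (x + 1) t"
  note c = cadlag_paths[OF assms(1)]
  have ab: "1 \<le> a" "1 \<le> b" "a \<le> 1 + T" "b \<le> 1 + T"
    using local_time_ge_1[OF c assms(2)] local_time_le[OF c assms(2), of x] local_time_le[OF c assms(2), of "x + 1"] assms(3)
    by (auto simp: a_def b_def)
  have "0 \<le> W a" "0 \<le> W b" "W a \<le> T" "W b \<le> T"
    using W_nonneg W_le[of a] W_le[of b] ab by auto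
  moreover have "0 \<le> h / w a" "h / w a \<le> 1"
    using w_ge_1[OF ab(1)] assms by (auto simp: divide_le_eq)
  moreover have "\<bar>(if x < X t \<omega> then right_potential else left_potential) a b\<bar> \<le> 1"
    using right_potential_nonneg[OF ab(1,2)] right_potential_le_1[OF ab(1,2)] left_potential_nonpos[of a b]
      left_potential_ge[OF ab(1), of b] eta_le_1 by auto
  ultimately show ?thesis
    unfolding edge_value_def a_def[symmetric] b_def[symmetric] by linarith
qed

text \<open>Pairs of a starting site and a displacement: the eight single jumps starting at an end
  of the edge or at a neighbour of an end. By \<open>edge_value_one_jump\<close>, a single jump from
  any other site does not raise the value of the edge.\<close>

abbreviation edge_jumps :: "int \<Rightarrow> (int \<times> int) set" where
  "edge_jumps x \<equiv> {x - 1..x + 2} \<times> {- 1, 1}"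

text \<open>Of the eight jumps only the two crossings of the edge have a nonzero gain. The identity
  is what makes the expected gain of the jumps cancel the drift.\<close>

lemma edge_drift_sum:
  "(\<Sum>p\<in>edge_jumps x. jump_gain (path \<omega>) x t (fst p) (fst p + snd p) * indicat_real {fst p} (X t \<omega>)
      * w (local_time (path \<omega>) (fst p + snd p) t)) = edge_drift (path \<omega>) x t"
proof -
  let ?A = "indicat_real {x} (X t \<omega>) * (w (local_time (path \<omega>) (x + 1) t) * jump_gain (path \<omega>) x t x (x + 1))"
  let ?B = "indicat_real {x + 1} (X t \<omega>) * (w (local_time (path \<omega>) x t) * jump_gain (path \<omega>) x t (x + 1) x)"
  have "(\<Sum>p\<in>edge_jumps x. jump_gain (path \<omega>) x t (fst p) (fst p + snd p) * indicat_real {fst p} (X t \<omega>)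
      * w (local_time (path \<omega>) (fst p + snd p) t))
      = (\<Sum>p\<in>edge_jumps x. (if p = (x, 1) then ?A else 0) + (if p = (x + 1, - 1) then ?B else 0))"
    by (intro sum.cong refl) (auto simp: jump_gain_def)
  also have "\<dots> = ?A + ?B"
    by (simp add: sum.distrib)
  finally show ?thesis by (simp add: edge_drift_eq)
qed

text \<open>No jump, one jump and several jumps are merged into one inequality. The drift term
  appears in all cases; on the jump events its size, at most \<open>2 * w (1 + T) * h\<close>, is
  added back, which explains the summand \<open>2 * w (1 + T)\<close> in both constants.\<close>

lemma edge_value_step:
  assumes \<omega>: "\<omega> \<in> space M" and t: "0 \<le> t" "0 < h" "h \<le> 1" "t + h \<le> T"
  shows "edge_value (path \<omega>) x h (t + h) - edge_value (path \<omega>) x h t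
    \<le> - (h * edge_drift (path \<omega>) x t)
      + (\<Sum>p\<in>edge_jumps x. (jump_gain (path \<omega>) x t (fst p) (fst p + snd p) + (2 + 2 * w (1 + T)) * h)
            * indicat_real {fst p} (X t \<omega>) * one_jump (fst p + snd p) t h \<omega>)
      + (3 + 2 * w (1 + T)) * many_jumps t h \<omega>"
    (is "?\<Delta> \<le> - ?d + ?S + ?m")
proof -
  note c = cadlag_paths[OF \<omega>] and nn = nearest_neighbour[OF \<omega>]
  have "\<bar>h * edge_drift (path \<omega>) x t\<bar> \<le> h * (2 * w (1 + T))"
    unfolding abs_mult using edge_drift_bound[OF \<omega> t(1), of T x] t by (intro mult_mono) auto
  then have d: "?d \<le> 2 * w (1 + T) * h" by (simp add: mult.commute)
  have wT: "1 \<le> w (1 + T)" using w_ge_1[of "1 + T"] t by simp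
  consider (none) "jump_times (path \<omega>) t (t + h) = {}"
    | (one) v where "exactly_one_jump_to v (path \<omega>) t (t + h)"
    | (many) "more_than_one_jump (path \<omega>) t (t + h)"
    using more_than_one_jump_iff by blast
  then show ?thesis
  proof cases
    case none
    then have "one_jump v t h \<omega> = 0" for v by (auto simp: exactly_one_jump_to_def indicator_def)
    moreover have "many_jumps t h \<omega> = 0" using none by (simp add: more_than_one_jump_def indicator_def)
    ultimately show ?thesis using edge_value_no_jump[OF c t(1-3) none, of x] by simp
  next
    case many
    then have "one_jump v t h \<omega> = 0" for v by (auto simp: more_than_one_jump_iff indicator_def)
    moreover have "many_jumps t h \<omega> = 1" using many \<omega> by (simp add: indicator_def)
    moreover have "2 * w (1 + T) * h \<le> 2 * w (1 + T)" using wT t by simp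
    ultimately show ?thesis using edge_value_increment[OF c t(1-3), of x] d by simp
  next
    case one
    have v: "\<bar>v - X t \<omega>\<bar> = 1" by (rule exactly_one_jump_neighbour[OF c nn t(1) one])
    have J: "one_jump u t h \<omega> = (if u = v then 1 else 0)" for u
      using one \<omega> by (auto simp: exactly_one_jump_to_def indicator_def)
    have m: "many_jumps t h \<omega> = 0" using one by (auto simp: more_than_one_jump_iff indicator_def)
    let ?c = "jump_gain (path \<omega>) x t (X t \<omega>) v + (2 + 2 * w (1 + T)) * h"
    have "?S = (\<Sum>p\<in>edge_jumps x. if p = (X t \<omega>, v - X t \<omega>) then ?c else 0)"
      by (intro sum.cong refl) (simp only: J, auto simp: indicator_def)
    also have "\<dots> = (if (X t \<omega>, v - X t \<omega>) \<in> edge_jumps x then ?c else 0)"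
      by simp
    also have "(X t \<omega>, v - X t \<omega>) \<in> edge_jumps x \<longleftrightarrow> X t \<omega> \<in> {x - 1..x + 2}"
      using v by auto
    finally have S: "?S = (if X t \<omega> \<in> {x - 1..x + 2} then ?c else 0)" .
    note E = edge_value_one_jump[OF c t(1,2) one v, of x]
    show ?thesis
    proof (cases "X t \<omega> \<in> {x - 1..x + 2}")
      case True
      then show ?thesis using E d unfolding S m by (simp add: algebra_simps)
    next
      case False
      then have "edge_drift (path \<omega>) x t = 0" by (auto simp: edge_drift_def)
      then show ?thesis using E False unfolding S m by (simp del: atLeastAtMost_iff)
    qed
  qed
qed

text \<open>The supermartingale property up to a small error, tested against a nonnegative bounded
  weight \<open>G\<close> known at time \<open>t\<close>: to first order the expected gain of the
  jumps equals the drift term and cancels it.\<close>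

lemma expectation_edge_value_step:
  assumes t: "0 \<le> t" "0 < h" "h \<le> 1" "t + h \<le> T"
    and r: "\<And>v. AE \<omega> in M. \<bar>v - X t \<omega>\<bar> = 1 \<longrightarrow>
         \<bar>cond_probability M (F t) (\<lambda>\<omega>'. exactly_one_jump_to v (path \<omega>') t (t + h)) \<omega>
            - w (local_time (path \<omega>) v t) * h\<bar> \<le> r"
    and r': "AE \<omega> in M. cond_probability M (F t) (\<lambda>\<omega>'. more_than_one_jump (path \<omega>') t (t + h)) \<omega> \<le> r"
    and G: "G \<in> borel_measurable (F t)" "\<And>\<omega>. \<omega> \<in> space M \<Longrightarrow> 0 \<le> G \<omega>" "\<And>\<omega>. \<omega> \<in> space M \<Longrightarrow> G \<omega> \<le> C"
  shows "(LINT \<omega>|M. G \<omega> * (edge_value (path \<omega>) x h (t + h) - edge_value (path \<omega>) x h t))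
    \<le> C * (35 + 18 * w (1 + T)) * w (1 + T) * (h\<^sup>2 + \<bar>r\<bar>)"
proof -
  define B where "B = 2 + 2 * w (1 + T)"
  have wT: "1 \<le> w (1 + T)" using w_ge_1[of "1 + T"] t by simp
  have B: "0 \<le> B" using wT by (simp add: B_def)
  have C: "0 \<le> C" using G(2,3) not_empty by fastforce
  let ?L = "\<lambda>\<omega> v. local_time (path \<omega>) v t"
  let ?g = "\<lambda>p \<omega>. jump_gain (path \<omega>) x t (fst p) (fst p + snd p)"
  let ?G = "\<lambda>p \<omega>. G \<omega> * (?g p \<omega> + B * h)"
  let ?E = "\<lambda>t \<omega>. edge_value (path \<omega>) x h t"
  let ?d = "\<lambda>\<omega>. edge_drift (path \<omega>) x t"
  have GF: "?G p \<in> borel_measurable (F t)" for p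
    using jump_gain_measurable[OF t(1)] G(1) by (intro borel_measurable_times borel_measurable_add) auto
  have Gb: "\<bar>?G p \<omega>\<bar> \<le> C * (2 + B)" if "\<omega> \<in> space M" for p \<omega>
  proof -
    have "B * h \<le> B" using B t by (simp add: mult_left_le)
    then have "\<bar>?g p \<omega> + B * h\<bar> \<le> 2 + B"
      using jump_gain_bound[OF that t(1), of x "fst p" "fst p + snd p"] B t mult_nonneg_nonneg[of B h] by linarith
    then show ?thesis unfolding abs_mult using G(2,3)[OF that] C by (intro mult_mono) auto
  qed
  note meas_M = measurable_from_subalg[OF subalgebra_F]
  have EM: "(\<lambda>\<omega>. ?E s \<omega>) \<in> borel_measurable M" if "0 \<le> s" for s
    by (rule meas_M[OF edge_value_measurable[OF that]])
  have GM: "G \<in> borel_measurable M" by (rule meas_M[OF G(1)])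
  have IM: "(\<lambda>\<omega>. indicat_real {y} (X t \<omega>)) \<in> borel_measurable M" for y
    by (rule meas_M[OF indicator_X_measurable[OF t(1)]])
  have wM: "(\<lambda>\<omega>. w (?L \<omega> v)) \<in> borel_measurable M" for v
    by (rule meas_M[OF w_local_time_measurable[OF t(1)]])
  have dM: "?d \<in> borel_measurable M"
    by (rule meas_M[OF edge_drift_measurable[OF t(1)]])
  have JM: "one_jump v t h \<in> borel_measurable M" for v
    using one_jump_measurable[of t "t + h" v] t by (intro borel_measurable_indicator) auto
  have mM: "many_jumps t h \<in> borel_measurable M"
    using more_than_one_jump_measurable[of t "t + h"] t by (intro borel_measurable_indicator) auto
  have i1: "integrable M (\<lambda>\<omega>. G \<omega> * (?E (t + h) \<omega> - ?E t \<omega>))"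
  proof (rule bounded_integrable[of _ "C * (2 * (T + 2))"])
    fix \<omega> assume \<omega>: "\<omega> \<in> space M"
    have "\<bar>?E (t + h) \<omega> - ?E t \<omega>\<bar> \<le> 2 * (T + 2)"
      using edge_value_bound[OF \<omega>, of "t + h" T h x] edge_value_bound[OF \<omega>, of t T h x] t by auto
    then show "\<bar>G \<omega> * (?E (t + h) \<omega> - ?E t \<omega>)\<bar> \<le> C * (2 * (T + 2))"
      unfolding abs_mult using G(2,3)[OF \<omega>] C by (intro mult_mono) auto
  qed (use EM GM t in auto)
  have i2: "integrable M (\<lambda>\<omega>. G \<omega> * (h * ?d \<omega>))"
  proof (rule bounded_integrable[of _ "C * (h * (2 * w (1 + T)))"])
    fix \<omega> assume \<omega>: "\<omega> \<in> space M"
    show "\<bar>G \<omega> * (h * ?d \<omega>)\<bar> \<le> C * (h * (2 * w (1 + T)))"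
      unfolding abs_mult using G(2,3)[OF \<omega>] C t edge_drift_bound[OF \<omega> t(1), of T x] by (intro mult_mono) auto
  qed (use GM dM in auto)
  have i3: "integrable M (\<lambda>\<omega>. ?G p \<omega> * indicat_real {fst p} (X t \<omega>) * one_jump (fst p + snd p) t h \<omega>)" for p
  proof (rule bounded_integrable[of _ "C * (2 + B)"])
    fix \<omega> assume "\<omega> \<in> space M"
    from Gb[OF this, of p] show "\<bar>?G p \<omega> * indicat_real {fst p} (X t \<omega>) * one_jump (fst p + snd p) t h \<omega>\<bar> \<le> C * (2 + B)"
      using B C by (auto simp: indicator_def)
  qed (intro borel_measurable_times IM JM meas_M[OF GF])
  have i4: "integrable M (\<lambda>\<omega>. G \<omega> * many_jumps t h \<omega>)"
  proof (rule bounded_integrable[of _ C])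
    fix \<omega> assume "\<omega> \<in> space M"
    from G(2,3)[OF this] show "\<bar>G \<omega> * many_jumps t h \<omega>\<bar> \<le> C" using C by (auto simp: indicator_def)
  qed (intro borel_measurable_times mM GM)
  have i5: "integrable M (\<lambda>\<omega>. ?G p \<omega> * indicat_real {fst p} (X t \<omega>) * (w (?L \<omega> (fst p + snd p)) * h))" for p
  proof (rule bounded_integrable[of _ "C * (2 + B) * (w (1 + T) * h)"])
    fix \<omega> assume \<omega>: "\<omega> \<in> space M"
    have "\<bar>?G p \<omega> * indicat_real {fst p} (X t \<omega>)\<bar> \<le> C * (2 + B)"
      using Gb[OF \<omega>, of p] B C by (auto simp: indicator_def)
    then show "\<bar>?G p \<omega> * indicat_real {fst p} (X t \<omega>) * (w (?L \<omega> (fst p + snd p)) * h)\<bar> \<le> C * (2 + B) * (w (1 + T) * h)"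
      unfolding abs_mult[of "?G p \<omega> * indicat_real {fst p} (X t \<omega>)"]
      using w_local_time_bounds[OF \<omega> t(1), of T "fst p + snd p"] t C B by (intro mult_mono) auto
  qed (intro borel_measurable_times IM wM meas_M[OF GF] borel_measurable_const)
  have "(LINT \<omega>|M. G \<omega> * (?E (t + h) \<omega> - ?E t \<omega>))
    \<le> (LINT \<omega>|M. - (G \<omega> * (h * ?d \<omega>))
        + (\<Sum>p\<in>edge_jumps x. ?G p \<omega> * indicat_real {fst p} (X t \<omega>) * one_jump (fst p + snd p) t h \<omega>)
        + (B + 1) * (G \<omega> * many_jumps t h \<omega>))"
  proof (rule integral_mono[OF i1])
    fix \<omega> assume \<omega>: "\<omega> \<in> space M"
    show "G \<omega> * (?E (t + h) \<omega> - ?E t \<omega>) \<le> - (G \<omega> * (h * ?d \<omega>))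
        + (\<Sum>p\<in>edge_jumps x. ?G p \<omega> * indicat_real {fst p} (X t \<omega>) * one_jump (fst p + snd p) t h \<omega>)
        + (B + 1) * (G \<omega> * many_jumps t h \<omega>)"
      using mult_left_mono[OF edge_value_step[OF \<omega> t, of x] G(2)[OF \<omega>]]
      unfolding B_def by (simp only: distrib_left sum_distrib_left mult_minus_right mult.assoc) (simp add: algebra_simps)
  qed (intro Bochner_Integration.integrable_add Bochner_Integration.integrable_minus Bochner_Integration.integrable_sum i2 i3 integrable_mult_right i4)
  also have "\<dots> = - (LINT \<omega>|M. G \<omega> * (h * ?d \<omega>))
      + (\<Sum>p\<in>edge_jumps x. LINT \<omega>|M. ?G p \<omega> * indicat_real {fst p} (X t \<omega>) * one_jump (fst p + snd p) t h \<omega>)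
      + (B + 1) * (LINT \<omega>|M. G \<omega> * many_jumps t h \<omega>)"
    by (simp only: Bochner_Integration.integral_add Bochner_Integration.integral_minus Bochner_Integration.integral_sum
        integral_mult_right_zero Bochner_Integration.integrable_add Bochner_Integration.integrable_minus
        Bochner_Integration.integrable_sum i2 i3 integrable_mult_right i4)
  also have "(LINT \<omega>|M. G \<omega> * many_jumps t h \<omega>) \<le> C * \<bar>r\<bar>"
  proof -
    have im: "integrable M (many_jumps t h)"
      by (rule bounded_integrable[of _ 1], rule mM) (auto simp: indicator_def)
    have "(LINT \<omega>|M. G \<omega> * many_jumps t h \<omega>) \<le> (LINT \<omega>|M. C * many_jumps t h \<omega>)"
      by (intro integral_mono i4 integrable_mult_right im mult_right_mono G(3)) auto
    also have "\<dots> = C * (LINT \<omega>|M. many_jumps t h \<omega>)"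
      by (rule integral_mult_right_zero)
    also have "\<dots> \<le> C * \<bar>r\<bar>"
      by (intro mult_left_mono expectation_many_jumps t r' C)
    finally show ?thesis .
  qed
  also have "(\<Sum>p\<in>edge_jumps x. LINT \<omega>|M. ?G p \<omega> * indicat_real {fst p} (X t \<omega>) * one_jump (fst p + snd p) t h \<omega>)
     \<le> (\<Sum>p\<in>edge_jumps x. (LINT \<omega>|M. ?G p \<omega> * indicat_real {fst p} (X t \<omega>) * (w (?L \<omega> (fst p + snd p)) * h)) + C * (2 + B) * \<bar>r\<bar>)"
    by (intro sum_mono expectation_one_jump[OF t(1,2) r GF Gb]) auto
  also have "\<dots> = (\<Sum>p\<in>edge_jumps x. (LINT \<omega>|M. ?G p \<omega> * indicat_real {fst p} (X t \<omega>) * (w (?L \<omega> (fst p + snd p)) * h)))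
     + 8 * (C * (2 + B) * \<bar>r\<bar>)"
    by (simp add: sum.distrib card_cartesian_product)
  \<comment> \<open>Gain times rate sums to the drift by \<open>edge_drift_sum\<close>; the summand
    \<open>B * h\<close> meets the factor \<open>w * h\<close> and is of second order in
    \<open>h\<close>.\<close>
  also have "(\<Sum>p\<in>edge_jumps x. (LINT \<omega>|M. ?G p \<omega> * indicat_real {fst p} (X t \<omega>) * (w (?L \<omega> (fst p + snd p)) * h)))
     \<le> (LINT \<omega>|M. G \<omega> * (h * ?d \<omega>)) + 8 * (C * (B * h) * (w (1 + T) * h))"
  proof -
    have "(\<Sum>p\<in>edge_jumps x. (LINT \<omega>|M. ?G p \<omega> * indicat_real {fst p} (X t \<omega>) * (w (?L \<omega> (fst p + snd p)) * h)))
       = (LINT \<omega>|M. (\<Sum>p\<in>edge_jumps x. ?G p \<omega> * indicat_real {fst p} (X t \<omega>) * (w (?L \<omega> (fst p + snd p)) * h)))"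
      by (rule Bochner_Integration.integral_sum[symmetric]) (rule i5)
    also have "\<dots> \<le> (LINT \<omega>|M. G \<omega> * (h * ?d \<omega>) + 8 * (C * (B * h) * (w (1 + T) * h)))"
    proof (rule integral_mono)
      fix \<omega> assume \<omega>: "\<omega> \<in> space M"
      have "(\<Sum>p\<in>edge_jumps x. ?G p \<omega> * indicat_real {fst p} (X t \<omega>) * (w (?L \<omega> (fst p + snd p)) * h))
        = G \<omega> * (h * (\<Sum>p\<in>edge_jumps x. ?g p \<omega> * indicat_real {fst p} (X t \<omega>) * w (?L \<omega> (fst p + snd p))))
        + (\<Sum>p\<in>edge_jumps x. G \<omega> * (B * h) * indicat_real {fst p} (X t \<omega>) * (w (?L \<omega> (fst p + snd p)) * h))"
        unfolding sum_distrib_left sum.distrib[symmetric] by (intro sum.cong refl) (simp add: algebra_simps)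
      also have "(\<Sum>p\<in>edge_jumps x. G \<omega> * (B * h) * indicat_real {fst p} (X t \<omega>) * (w (?L \<omega> (fst p + snd p)) * h))
        \<le> (\<Sum>p\<in>edge_jumps x. C * (B * h) * 1 * (w (1 + T) * h))"
        using G(2,3)[OF \<omega>] w_local_time_bounds(2)[OF \<omega> t(1), of T] w_local_time_bounds(1)[OF \<omega> t(1), of T] B C t wT
        by (intro sum_mono mult_mono mult_nonneg_nonneg) (auto simp: indicator_def intro: order_trans[OF zero_le_one])
      also have "\<dots> = 8 * (C * (B * h) * (w (1 + T) * h))"
        by (simp add: card_cartesian_product)
      finally show "(\<Sum>p\<in>edge_jumps x. ?G p \<omega> * indicat_real {fst p} (X t \<omega>) * (w (?L \<omega> (fst p + snd p)) * h))
         \<le> G \<omega> * (h * ?d \<omega>) + 8 * (C * (B * h) * (w (1 + T) * h))"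
        unfolding edge_drift_sum by simp
    qed (use i2 i5 in \<open>auto intro!: Bochner_Integration.integrable_sum\<close>)
    also have "\<dots> = (LINT \<omega>|M. G \<omega> * (h * ?d \<omega>)) + 8 * (C * (B * h) * (w (1 + T) * h))"
      using i2 by (simp add: prob_space)
    finally show ?thesis .
  qed
  finally have "(LINT \<omega>|M. G \<omega> * (?E (t + h) \<omega> - ?E t \<omega>))
     \<le> 8 * (C * (B * h) * (w (1 + T) * h)) + 8 * (C * (2 + B) * \<bar>r\<bar>) + (B + 1) * (C * \<bar>r\<bar>)"
    using B by (simp add: mult_left_mono)
  \<comment> \<open>\<open>17 + 9 * B\<close> collects \<open>8 * (2 + B)\<close> from the eight
    single jumps and \<open>B + 1\<close> from multiple jumps; by the choice of \<open>B\<close> it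
    equals \<open>35 + 18 * w (1 + T)\<close>.\<close>
  also have "\<dots> = C * (8 * B * w (1 + T)) * h\<^sup>2 + C * (17 + 9 * B) * \<bar>r\<bar>"
    by (simp add: algebra_simps power2_eq_square)
  also have "\<dots> \<le> C * ((35 + 18 * w (1 + T)) * w (1 + T)) * h\<^sup>2 + C * ((35 + 18 * w (1 + T)) * w (1 + T)) * \<bar>r\<bar>"
  proof -
    have "8 * B \<le> 35 + 18 * w (1 + T)" "17 + 9 * B = 35 + 18 * w (1 + T)" using wT by (auto simp: B_def)
    then have "8 * B * w (1 + T) \<le> (35 + 18 * w (1 + T)) * w (1 + T)"
      "17 + 9 * B \<le> (35 + 18 * w (1 + T)) * w (1 + T)"
      using wT mult_left_mono[of 1 "w (1 + T)" "35 + 18 * w (1 + T)"] by (auto intro: mult_right_mono)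
    then show ?thesis using C by (intro add_mono mult_right_mono[OF mult_left_mono]) auto
  qed
  also have "\<dots> = C * (35 + 18 * w (1 + T)) * w (1 + T) * (h\<^sup>2 + \<bar>r\<bar>)"
    by (simp add: algebra_simps)
  finally show ?thesis .
qed

section \<open>Sum over the edges and soft stopping at the origin\<close>

definition total_value :: "nat \<Rightarrow> real \<Rightarrow> real \<Rightarrow> real \<Rightarrow> 'a \<Rightarrow> real" where
  "total_value n K h t \<omega> =
     (\<Sum>x<n. edge_value (path \<omega>) (int x) h t) + n * (eta / 4) + (K - 1)"

text \<open>A Lipschitz substitute for stopping when the local time of \<open>0\<close> reaches
  \<open>K\<close>: it decreases to 0 and stays there, so no stopping time enters.\<close>

definition cutoff :: "real \<Rightarrow> real \<Rightarrow> 'a \<Rightarrow> real" where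
  "cutoff K t \<omega> = max 0 (K - local_time (path \<omega>) 0 t)"

text \<open>The \<open>W\<close> terms telescope, and \<open>W\<close> at the origin is at most its
  local time minus 1; this is what the constant \<open>K - 1\<close> in \<open>total_value\<close>
  absorbs. The constant \<open>n * (eta / 4)\<close> absorbs the worst left potential of every edge,
  and it survives as a surplus when the walk is at or beyond \<open>n\<close>, since then all
  \<open>n\<close> potentials are right potentials and nonnegative.\<close>

lemma total_value_ge:
  assumes \<omega>: "\<omega> \<in> space M" and t: "0 \<le> t" "0 \<le> h"
  shows "K - local_time (path \<omega>) 0 t + (if int n \<le> X t \<omega> then n * (eta / 4) else 0) \<le> total_value n K h t \<omega>"
proof -
  let ?L = "\<lambda>v. local_time (path \<omega>) v t"
  define c where "c = (if int n \<le> X t \<omega> then eta / 4 else 0)"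
  have L: "1 \<le> ?L v" for v by (rule local_time_ge_1[OF cadlag_paths[OF \<omega>] t(1)])
  have "W (?L (int (Suc x))) - W (?L (int x)) + c \<le> edge_value (path \<omega>) (int x) h t + eta / 4" if "x < n" for x
  proof -
    have Suc: "int (Suc x) = int x + 1" by simp
    have "0 \<le> h / w (?L (int x))"
      using w_ge_1[OF L[of "int x"]] t by simp
    moreover have "c \<le> (if int x < X t \<omega> then right_potential else left_potential) (?L (int x)) (?L (int x + 1)) + eta / 4"
      using right_potential_nonneg[OF L[of "int x"] L[of "int x + 1"]] left_potential_ge[OF L[of "int x"], of "?L (int x + 1)"] eta_pos that
      by (auto simp: c_def)
    ultimately show ?thesis unfolding edge_value_def Suc by linarith
  qed
  then have "(\<Sum>x<n. W (?L (int (Suc x))) - W (?L (int x)) + c) \<le> (\<Sum>x<n. edge_value (path \<omega>) (int x) h t + eta / 4)"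
    by (intro sum_mono) auto
  moreover have "(\<Sum>x<n. W (?L (int (Suc x))) - W (?L (int x)) + c) = W (?L (int n)) - W (?L 0) + n * c"
    using sum_lessThan_telescope[of "\<lambda>x. W (?L (int x))" n] by (simp add: sum.distrib)
  moreover have "W (?L 0) \<le> ?L 0 - 1" "0 \<le> W (?L (int n))"
    using W_le[OF L] W_nonneg[OF L] by auto
  moreover have "n * c = (if int n \<le> X t \<omega> then n * (eta / 4) else 0)"
    by (simp add: c_def)
  ultimately show ?thesis by (simp add: total_value_def sum.distrib)
qed

text \<open>Initially the walk is to the left of every edge and each potential is
  \<open>- (eta / 4)\<close>, exactly cancelled by the constant. Only the corrections
  \<open>h / w 1\<close> are left over.\<close>

lemma total_value_start:
  assumes "\<omega> \<in> space M" "X 0 \<omega> = 0"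
  shows "total_value n K h 0 \<omega> = n * h + (K - 1)"
proof -
  have "edge_value (path \<omega>) (int x) h 0 = - (eta / 4) + h" for x
    using assms by (simp add: edge_value_def local_time_0 left_potential_1_1 w_1)
  then show ?thesis by (simp only: total_value_def) (simp add: algebra_simps)
qed

text \<open>Discrete product rule. The extra term is the decrease of the cutoff times the new total
  value. It is nonpositive while the local time of \<open>0\<close> is at most \<open>K\<close>,
  because the total value is then nonnegative. In the step that passes \<open>K\<close>, the cutoff
  was at most \<open>h\<close> and the total value is at least \<open>- h\<close>.\<close>

lemma cutoff_product_step:
  assumes \<omega>: "\<omega> \<in> space M" and t: "0 \<le> t" "0 < h"
  shows "cutoff K (t + h) \<omega> * total_value n K h (t + h) \<omega>
    \<le> cutoff K t \<omega> * total_value n K h t \<omega>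
      + (\<Sum>x<n. cutoff K t \<omega> * (edge_value (path \<omega>) (int x) h (t + h) - edge_value (path \<omega>) (int x) h t)) + h\<^sup>2"
proof -
  let ?V = "\<lambda>t. total_value n K h t \<omega>"
  define l l' where "l = local_time (path \<omega>) 0 t" and "l' = local_time (path \<omega>) 0 (t + h)"
  have l: "l \<le> l'" "l' \<le> l + h"
    using local_time_increment_bounds[OF cadlag_paths[OF \<omega>] t(1), of "t + h" 0] t by (auto simp: l_def l'_def)
  have "0 \<le> (if int n \<le> X (t + h) \<omega> then n * (eta / 4) else 0)" using eta_pos by simp
  then have V: "K - l' \<le> ?V (t + h)"
    using total_value_ge[OF \<omega>, of "t + h" h K n] t unfolding l'_def by linarith
  have "(max 0 (K - l') - max 0 (K - l)) * ?V (t + h) \<le> h\<^sup>2"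
  proof (cases "l' \<le> K")
    case True
    then show ?thesis using l V by (intro order_trans[OF mult_nonpos_nonneg]) auto
  next
    case False
    have "max 0 (K - l) * - ?V (t + h) \<le> max 0 (K - l) * (l' - K)"
      using V by (intro mult_left_mono) auto
    also have "\<dots> \<le> h * h"
    proof (cases "l < K")
      case True
      then show ?thesis using False l t by (intro mult_mono) auto
    qed (use t in simp)
    finally show ?thesis using False by (simp add: power2_eq_square)
  qed
  then have "cutoff K (t + h) \<omega> * ?V (t + h) - cutoff K t \<omega> * ?V (t + h) \<le> h\<^sup>2"
    unfolding cutoff_def l_def[symmetric] l'_def[symmetric] left_diff_distrib .
  moreover have "?V (t + h) - ?V t = (\<Sum>x<n. edge_value (path \<omega>) (int x) h (t + h) - edge_value (path \<omega>) (int x) h t)"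
    by (simp add: total_value_def sum_subtractf)
  then have "cutoff K t \<omega> * ?V (t + h) - cutoff K t \<omega> * ?V t
    = (\<Sum>x<n. cutoff K t \<omega> * (edge_value (path \<omega>) (int x) h (t + h) - edge_value (path \<omega>) (int x) h t))"
    unfolding sum_distrib_left[symmetric] right_diff_distrib[symmetric] by simp
  ultimately show ?thesis by linarith
qed

lemma cutoff_measurable_F: "0 \<le> t \<Longrightarrow> cutoff K t \<in> borel_measurable (F t)"
  unfolding cutoff_def using local_time_measurable_F[of t 0] by measurable

lemma cutoff_bounds:
  assumes "\<omega> \<in> space M" "0 \<le> t"
  shows "0 \<le> cutoff K t \<omega>" "1 \<le> K \<Longrightarrow> cutoff K t \<omega> \<le> K - 1"
  using local_time_ge_1[OF cadlag_paths[OF assms(1)] assms(2), of 0] by (auto simp: cutoff_def)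

lemma cutoff_product_integrable:
  assumes t: "0 \<le> t" "0 \<le> h" "h \<le> 1" and K: "1 \<le> K"
  shows "integrable M (\<lambda>\<omega>. cutoff K t \<omega> * total_value n K h t \<omega>)"
proof (rule bounded_integrable)
  have "(\<lambda>\<omega>. edge_value (path \<omega>) (int x) h t) \<in> borel_measurable M" for x
    by (rule measurable_from_subalg[OF subalgebra_F edge_value_measurable[OF t(1)]])
  then show "(\<lambda>\<omega>. cutoff K t \<omega> * total_value n K h t \<omega>) \<in> borel_measurable M"
    unfolding total_value_def using measurable_from_subalg[OF subalgebra_F cutoff_measurable_F[OF t(1), of K]]
    by measurable
  fix \<omega> assume \<omega>: "\<omega> \<in> space M"
  have "\<bar>\<Sum>x<n. edge_value (path \<omega>) (int x) h t\<bar> \<le> (\<Sum>x<n. t + 2)"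
    using edge_value_bound[OF \<omega> t(1) order_refl t(2,3)] by (intro order_trans[OF sum_abs] sum_mono) auto
  then have "\<bar>total_value n K h t \<omega>\<bar> \<le> n * (t + 2) + n * (eta / 4) + (K - 1)"
    unfolding total_value_def using K eta_pos mult_nonneg_nonneg[of "real n" "eta / 4"] by (simp del: mult_nonneg_nonneg)
  then show "\<bar>cutoff K t \<omega> * total_value n K h t \<omega>\<bar> \<le> (K - 1) * (n * (t + 2) + n * (eta / 4) + (K - 1))"
    unfolding abs_mult using cutoff_bounds[OF \<omega> t(1), of K] K by (intro mult_mono) auto
qed

lemma expectation_cutoff_product_step:
  assumes t: "0 \<le> t" "0 < h" "h \<le> 1" "t + h \<le> T" and K: "1 \<le> K"
    and r: "\<And>v. AE \<omega> in M. \<bar>v - X t \<omega>\<bar> = 1 \<longrightarrow>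
         \<bar>cond_probability M (F t) (\<lambda>\<omega>'. exactly_one_jump_to v (path \<omega>') t (t + h)) \<omega>
            - w (local_time (path \<omega>) v t) * h\<bar> \<le> r"
    and r': "AE \<omega> in M. cond_probability M (F t) (\<lambda>\<omega>'. more_than_one_jump (path \<omega>') t (t + h)) \<omega> \<le> r"
  shows "(LINT \<omega>|M. cutoff K (t + h) \<omega> * total_value n K h (t + h) \<omega>)
    \<le> (LINT \<omega>|M. cutoff K t \<omega> * total_value n K h t \<omega>)
      + n * ((K - 1) * (35 + 18 * w (1 + T)) * w (1 + T) * (h\<^sup>2 + \<bar>r\<bar>)) + h\<^sup>2"
proof -
  let ?I = "\<lambda>x \<omega>. cutoff K t \<omega> * (edge_value (path \<omega>) (int x) h (t + h) - edge_value (path \<omega>) (int x) h t)"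
  have int: "integrable M (\<lambda>\<omega>. ?I x \<omega>)" for x
  proof (rule bounded_integrable[of _ "(K - 1) * (2 * (T + 2))"])
    have "(\<lambda>\<omega>. edge_value (path \<omega>) (int x) h s) \<in> borel_measurable M" if "0 \<le> s" for s
      by (rule measurable_from_subalg[OF subalgebra_F edge_value_measurable[OF that]])
    then show "?I x \<in> borel_measurable M"
      using t measurable_from_subalg[OF subalgebra_F cutoff_measurable_F[OF t(1), of K]]
      by (intro borel_measurable_times borel_measurable_diff) auto
    fix \<omega> assume \<omega>: "\<omega> \<in> space M"
    have "\<bar>edge_value (path \<omega>) (int x) h (t + h) - edge_value (path \<omega>) (int x) h t\<bar> \<le> 2 * (T + 2)"
      using edge_value_bound[OF \<omega>, of "t + h" T h "int x"] edge_value_bound[OF \<omega>, of t T h "int x"] t by auto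
    then show "\<bar>?I x \<omega>\<bar> \<le> (K - 1) * (2 * (T + 2))"
      unfolding abs_mult using cutoff_bounds[OF \<omega> t(1), of K] K by (intro mult_mono) auto
  qed
  have i0: "integrable M (\<lambda>\<omega>. cutoff K t \<omega> * total_value n K h t \<omega>)"
    using t K by (intro cutoff_product_integrable) auto
  have "(LINT \<omega>|M. cutoff K (t + h) \<omega> * total_value n K h (t + h) \<omega>)
    \<le> (LINT \<omega>|M. cutoff K t \<omega> * total_value n K h t \<omega> + (\<Sum>x<n. ?I x \<omega>) + h\<^sup>2)"
    by (rule integral_mono)
      (use t K i0 int cutoff_product_step in \<open>auto intro!: cutoff_product_integrable Bochner_Integration.integrable_add Bochner_Integration.integrable_sum\<close>)
  also have "\<dots> = (LINT \<omega>|M. cutoff K t \<omega> * total_value n K h t \<omega>) + (\<Sum>x<n. LINT \<omega>|M. ?I x \<omega>) + h\<^sup>2"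
    using i0 int by (simp add: prob_space)
  also have "(\<Sum>x<n. LINT \<omega>|M. ?I x \<omega>) \<le> (\<Sum>x<n. (K - 1) * (35 + 18 * w (1 + T)) * w (1 + T) * (h\<^sup>2 + \<bar>r\<bar>))"
    using cutoff_bounds t K
    by (intro sum_mono expectation_edge_value_step[OF t r r' cutoff_measurable_F]) auto
  finally show ?thesis by simp
qed

lemma position_local_time_measurable:
  assumes "0 \<le> t"
  shows "{\<omega> \<in> space M. P (X t \<omega>) \<and> local_time (path \<omega>) v t \<le> c} \<in> sets M"
proof -
  have [measurable]: "(\<lambda>\<omega>. local_time (path \<omega>) v t) \<in> borel_measurable M"
    by (rule local_time_measurable[OF assms])
  have "(X t -` Collect P \<inter> space M) \<inter> {\<omega> \<in> space M. local_time (path \<omega>) v t \<le> c} \<in> sets M"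
    by (intro sets.Int measurable_sets[OF measurable_X[OF assms]]) auto
  also have "(X t -` Collect P \<inter> space M) \<inter> {\<omega> \<in> space M. local_time (path \<omega>) v t \<le> c}
    = {\<omega> \<in> space M. P (X t \<omega>) \<and> local_time (path \<omega>) v t \<le> c}" by auto
  finally show ?thesis .
qed

text \<open>Along a grid of mesh \<open>h\<close> the expected product of cutoff and total value
  starts near the square of \<open>K - 1\<close>, and the errors of about \<open>T / h\<close> steps
  vanish as \<open>h\<close> tends to 0. At time \<open>T\<close> the product is at least
  \<open>n * (eta / 4)\<close> on the event and nonnegative elsewhere.\<close>

lemma prob_reach_bound:
  assumes T: "0 < T" and K: "1 \<le> K" and X0: "AE \<omega> in M. X 0 \<omega> = 0"
  shows "prob {\<omega> \<in> space M. int n \<le> X T \<omega> \<and> local_time (path \<omega>) 0 T \<le> K - 1} * (n * (eta / 4)) \<le> (K - 1)\<^sup>2"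
proof -
  let ?B = "{\<omega> \<in> space M. int n \<le> X T \<omega> \<and> local_time (path \<omega>) 0 T \<le> K - 1}"
  define c where "c = n * ((K - 1) * (35 + 18 * w (1 + T)) * w (1 + T))"
  have "1 \<le> w (1 + T)" using w_ge_1[of "1 + T"] T by simp
  then have c: "0 \<le> c" using K by (simp add: c_def)
  obtain r where ro: "r \<in> o[at_right 0](\<lambda>h. h)" and r: "\<forall>t\<in>{0..T}. \<forall>h>0.
      (\<forall>v. AE \<omega> in M. \<bar>v - X t \<omega>\<bar> = 1 \<longrightarrow>
         \<bar>cond_probability M (F t) (\<lambda>\<omega>'. exactly_one_jump_to v (path \<omega>') t (t + h)) \<omega>
            - w (local_time (path \<omega>) v t) * h\<bar> \<le> r h) \<and>
      (AE \<omega> in M. cond_probability M (F t) (\<lambda>\<omega>'. more_than_one_jump (path \<omega>') t (t + h)) \<omega> \<le> r h)"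
    using jump_rates[of T] T by auto
  let ?Z = "\<lambda>h t. LINT \<omega>|M. cutoff K t \<omega> * total_value n K h t \<omega>"
  have BM: "?B \<in> sets M" by (rule position_local_time_measurable) (use T in simp)
  have grid: "?Z h (real k * h) \<le> (K - 1) * (n * h + (K - 1)) + real k * (c * (h\<^sup>2 + \<bar>r h\<bar>) + h\<^sup>2)"
    if h: "0 < h" "h \<le> 1" and k: "real k * h \<le> T" for h :: real and k
    using k
  proof (induction k)
    case 0
    have "?Z h 0 \<le> (LINT \<omega>|M. (K - 1) * (n * h + (K - 1)))"
    proof (rule integral_mono_AE)
      show "AE \<omega> in M. cutoff K 0 \<omega> * total_value n K h 0 \<omega> \<le> (K - 1) * (n * h + (K - 1))"
        using X0 AE_space
      proof eventually_elim
        case (elim \<omega>)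
        then show ?case using K by (simp add: total_value_start cutoff_def local_time_0)
      qed
    qed (use h K in \<open>auto intro!: cutoff_product_integrable\<close>)
    then show ?case by (simp add: prob_space)
  next
    case (Suc k)
    have t: "0 \<le> real k * h" "real k * h + h \<le> T" using Suc.prems h by (auto simp: algebra_simps)
    have rr: "\<And>v. AE \<omega> in M. \<bar>v - X (real k * h) \<omega>\<bar> = 1 \<longrightarrow>
         \<bar>cond_probability M (F (real k * h)) (\<lambda>\<omega>'. exactly_one_jump_to v (path \<omega>') (real k * h) (real k * h + h)) \<omega>
            - w (local_time (path \<omega>) v (real k * h)) * h\<bar> \<le> r h"
      "AE \<omega> in M. cond_probability M (F (real k * h)) (\<lambda>\<omega>'. more_than_one_jump (path \<omega>') (real k * h) (real k * h + h)) \<omega> \<le> r h"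
      using r[rule_format, of "real k * h" h] t h by auto
    have "?Z h (real k * h + h) \<le> ?Z h (real k * h) + n * ((K - 1) * (35 + 18 * w (1 + T)) * w (1 + T) * (h\<^sup>2 + \<bar>r h\<bar>)) + h\<^sup>2"
      by (rule expectation_cutoff_product_step[OF t(1) h t(2) K rr])
    also have "n * ((K - 1) * (35 + 18 * w (1 + T)) * w (1 + T) * (h\<^sup>2 + \<bar>r h\<bar>)) = c * (h\<^sup>2 + \<bar>r h\<bar>)"
      by (simp add: c_def)
    also have "?Z h (real k * h) \<le> (K - 1) * (n * h + (K - 1)) + real k * (c * (h\<^sup>2 + \<bar>r h\<bar>) + h\<^sup>2)"
      using Suc.IH t h by simp
    also have "real k * h + h = real (Suc k) * h" by (simp add: algebra_simps)
    finally show ?case by (simp add: algebra_simps)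
  qed
  have lower: "prob ?B * (n * (eta / 4)) \<le> ?Z h T" if h: "0 < h" "h \<le> 1" for h :: real
  proof -
    have "?B \<inter> space M = ?B" by auto
    then have "(LINT \<omega>|M. indicat_real ?B \<omega>) = prob ?B"
      using Bochner_Integration.integral_indicator[of M ?B] by (simp only:)
    then have "prob ?B * (n * (eta / 4)) = (LINT \<omega>|M. indicat_real ?B \<omega> * (n * (eta / 4)))"
      by (simp only: integral_mult_left_zero)
    also have "\<dots> \<le> ?Z h T"
    proof (rule integral_mono)
      fix \<omega> assume \<omega>: "\<omega> \<in> space M"
      let ?l = "local_time (path \<omega>) 0 T"
      let ?i = "if int n \<le> X T \<omega> then n * (eta / 4) else 0"
      have V: "K - ?l + ?i \<le> total_value n K h T \<omega>"
        using total_value_ge[OF \<omega>, of T h K n] T h by simp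
      have i: "0 \<le> ?i" using eta_pos by simp
      show "indicat_real ?B \<omega> * (n * (eta / 4)) \<le> cutoff K T \<omega> * total_value n K h T \<omega>"
      proof (cases "\<omega> \<in> ?B")
        case True
        \<comment> \<open>The threshold \<open>K - 1\<close> in the event leaves the cutoff at least
          1.\<close>
        then have "1 * (n * (eta / 4)) \<le> cutoff K T \<omega> * total_value n K h T \<omega>"
          using V eta_pos by (intro mult_mono) (auto simp: cutoff_def)
        then show ?thesis using True by simp
      next
        case False
        \<comment> \<open>The total value can be negative only once the local time of
          \<open>0\<close> exceeds \<open>K\<close>, and then the cutoff is 0.\<close>
        have "0 \<le> cutoff K T \<omega> * total_value n K h T \<omega>"
        proof (cases "?l \<le> K")
          case True
          then have "0 \<le> total_value n K h T \<omega>" using V i by linarith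
          then show ?thesis by (simp add: cutoff_def)
        qed (simp add: cutoff_def)
        then show ?thesis using False by simp
      qed
    next
      show "integrable M (\<lambda>\<omega>. indicat_real ?B \<omega> * (n * (eta / 4)))"
        by (rule bounded_integrable[of _ "n * (eta / 4)"],
            intro borel_measurable_times borel_measurable_indicator BM borel_measurable_const)
          (use eta_pos in \<open>simp add: indicator_def\<close>)
      show "integrable M (\<lambda>\<omega>. cutoff K T \<omega> * total_value n K h T \<omega>)"
        by (rule cutoff_product_integrable) (use h K T in simp_all)
    qed
    finally show ?thesis .
  qed
  \<comment> \<open>These meshes divide \<open>T\<close>, so the grid ends exactly at
    \<open>T\<close>.\<close>
  define h where "h = (\<lambda>N. T / real (Suc N))"
  have h0: "filterlim h (at_right 0) sequentially"
    unfolding filterlim_at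
  proof
    have "(\<lambda>N. T * (1 / real (Suc N))) \<longlonglongrightarrow> T * 0"
      by (intro tendsto_intros LIMSEQ_Suc[OF lim_1_over_n])
    then show "h \<longlonglongrightarrow> 0" by (simp add: h_def)
    show "eventually (\<lambda>N. h N \<in> {0<..} \<and> h N \<noteq> 0) sequentially"
      using T by (simp add: h_def)
  qed
  then have h_lim: "h \<longlonglongrightarrow> 0"
    by (simp add: filterlim_at)
  have "((\<lambda>h. r h / h) \<longlongrightarrow> 0) (at_right 0)"
    by (rule smalloD_tendsto[OF ro])
  from tendsto_rabs[OF filterlim_compose[OF this h0]]
  have r_lim: "(\<lambda>N. \<bar>r (h N) / h N\<bar>) \<longlonglongrightarrow> 0" by simp
  have "(\<lambda>N. (K - 1) * (real n * h N + (K - 1)) + T * (c * (h N + \<bar>r (h N) / h N\<bar>) + h N))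
    \<longlonglongrightarrow> (K - 1) * (real n * 0 + (K - 1)) + T * (c * (0 + 0) + 0)"
    by (intro tendsto_intros h_lim r_lim)
  then have lim: "(\<lambda>N. (K - 1) * (real n * h N + (K - 1)) + T * (c * (h N + \<bar>r (h N) / h N\<bar>) + h N)) \<longlonglongrightarrow> (K - 1)\<^sup>2"
    by (simp add: power2_eq_square)
  have "eventually (\<lambda>N. h N < 1) sequentially"
    using order_tendstoD(2)[OF h_lim, of 1] by simp
  then have "eventually (\<lambda>N. prob ?B * (n * (eta / 4)) \<le> (K - 1) * (n * h N + (K - 1)) + T * (c * (h N + \<bar>r (h N) / h N\<bar>) + h N)) sequentially"
  proof eventually_elim
    case (elim N)
    have hN: "0 < h N" "h N \<le> 1" "real (Suc N) * h N = T" using elim T by (auto simp: h_def)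
    have "prob ?B * (n * (eta / 4)) \<le> ?Z (h N) T" by (rule lower[OF hN(1,2)])
    also have "\<dots> \<le> (K - 1) * (n * h N + (K - 1)) + real (Suc N) * (c * ((h N)\<^sup>2 + \<bar>r (h N)\<bar>) + (h N)\<^sup>2)"
      using grid[OF hN(1,2), of "Suc N"] unfolding hN(3) by simp
    \<comment> \<open>Factoring out \<open>h N\<close> turns the number of steps into the length
      \<open>T\<close> and leaves the quotient of \<open>r\<close> by \<open>h\<close>, which tends
      to 0.\<close>
    also have "(c * ((h N)\<^sup>2 + \<bar>r (h N)\<bar>) + (h N)\<^sup>2) = h N * (c * (h N + \<bar>r (h N) / h N\<bar>) + h N)"
      using hN by (simp add: abs_divide field_simps power2_eq_square)
    also have "real (Suc N) * (h N * (c * (h N + \<bar>r (h N) / h N\<bar>) + h N)) = T * (c * (h N + \<bar>r (h N) / h N\<bar>) + h N)"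
      unfolding mult.assoc[symmetric] hN(3) by simp
    finally show ?case .
  qed
  from tendsto_lowerbound[OF lim this] show ?thesis by simp
qed

end

section \<open>Reflection of the process\<close>

lemma tendsto_uminus_int_iff: "((\<lambda>t. - f t) \<longlongrightarrow> - l) G \<longleftrightarrow> (f \<longlongrightarrow> (l :: int)) G"
  by (simp add: tendsto_discrete)

lemma cadlag_uminus:
  assumes "cadlag f"
  shows "cadlag (\<lambda>t. - f t)"
  unfolding cadlag_def
proof (intro conjI allI impI)
  show "((\<lambda>t. - f t) \<longlongrightarrow> - f t) (at_right t)" if "0 \<le> t" for t
    using assms that by (simp add: cadlag_def tendsto_uminus_int_iff)
  show "\<exists>l. ((\<lambda>t. - f t) \<longlongrightarrow> l) (at_left t)" if t: "0 < t" for t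
  proof -
    obtain l where "(f \<longlongrightarrow> l) (at_left t)" using assms t unfolding cadlag_def by blast
    then have "((\<lambda>t. - f t) \<longlongrightarrow> - l) (at_left t)" by (simp only: tendsto_uminus_int_iff)
    then show ?thesis ..
  qed
qed

lemma jump_times_uminus: "jump_times (\<lambda>t. - f t) s t = jump_times f s t"
  by (simp add: jump_times_def tendsto_uminus_int_iff)

text \<open>Reflection keeps the generated sigma-algebras and the jump times and replaces
  \<open>v\<close> by \<open>- v\<close> in jump targets and local times. As the rate condition
  ranges over all \<open>v\<close>, it is only reindexed, with the same error function.\<close>

lemma vrjp_uminus:
  assumes "vrjp M w X"
  shows "vrjp M w (\<lambda>t \<omega>. - X t \<omega>)"
proof -
  interpret vrjp M w X by fact
  have filt: "natural_filtration M (\<lambda>t \<omega>. - X t \<omega>) t = natural_filtration M X t" for t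
  proof -
    have "{(\<lambda>\<omega>. - X s \<omega>) -` A \<inter> space M |s A. s \<in> {0..t}} = {X s -` A \<inter> space M |s A. s \<in> {0..t}}"
    proof (intro equalityI subsetI)
      fix S assume "S \<in> {(\<lambda>\<omega>. - X s \<omega>) -` A \<inter> space M |s A. s \<in> {0..t}}"
      then obtain s A where "S = (\<lambda>\<omega>. - X s \<omega>) -` A \<inter> space M" "s \<in> {0..t}" by auto
      then have "S = X s -` (uminus -` A) \<inter> space M \<and> s \<in> {0..t}" by auto
      then show "S \<in> {X s -` A \<inter> space M |s A. s \<in> {0..t}}" by blast
    next
      fix S assume "S \<in> {X s -` A \<inter> space M |s A. s \<in> {0..t}}"
      then obtain s A where "S = X s -` A \<inter> space M" "s \<in> {0..t}" by auto
      then have "S = (\<lambda>\<omega>. - X s \<omega>) -` (uminus -` A) \<inter> space M \<and> s \<in> {0..t}" by auto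
      then show "S \<in> {(\<lambda>\<omega>. - X s \<omega>) -` A \<inter> space M |s A. s \<in> {0..t}}" by blast
    qed
    then show ?thesis by (simp add: natural_filtration_def)
  qed
  have one: "exactly_one_jump_to v (\<lambda>t. - f t) s t \<longleftrightarrow> exactly_one_jump_to (- v) f s t" for v f s t
    by (auto simp: exactly_one_jump_to_def jump_times_uminus)
  have many: "more_than_one_jump (\<lambda>t. - f t) s t \<longleftrightarrow> more_than_one_jump f s t" for f s t
    by (simp add: more_than_one_jump_def jump_times_uminus)
  have lt: "local_time (\<lambda>t. - f t) v t = local_time f (- v) t" for v f t
  proof -
    have "indicat_real {v} (- f s) = indicat_real {- v} (f s)" for s by (auto simp: indicator_def)
    then show ?thesis by (simp add: local_time_def)
  qed
  show ?thesis
  proof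
    fix t :: real assume "0 \<le> t"
    from measurable_compose[OF measurable_X[OF this], of uminus "count_space UNIV"]
    show "(\<lambda>\<omega>. - X t \<omega>) \<in> measurable M (count_space UNIV)" by simp
  next
    fix \<omega> assume "\<omega> \<in> space M"
    then show "cadlag (\<lambda>t. - X t \<omega>)" by (intro cadlag_uminus cadlag_paths)
  next
    fix \<omega> assume \<omega>: "\<omega> \<in> space M"
    show "nearest_neighbour_jumps (\<lambda>t. - X t \<omega>)"
      unfolding nearest_neighbour_jumps_def
    proof (intro allI impI)
      fix t l assume "0 < t" "((\<lambda>t. - X t \<omega>) \<longlongrightarrow> l) (at_left t)" "- X t \<omega> \<noteq> l"
      moreover from this have "((\<lambda>t. X t \<omega>) \<longlongrightarrow> - l) (at_left t)"
        using tendsto_uminus_int_iff[of "\<lambda>t. X t \<omega>" "- l"] by simp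
      ultimately have "\<bar>X t \<omega> - - l\<bar> = 1"
        using nearest_neighbour[OF \<omega>] unfolding nearest_neighbour_jumps_def by fastforce
      then show "\<bar>- X t \<omega> - l\<bar> = 1" by linarith
    qed
  next
    fix T :: real assume "0 \<le> T"
    then obtain r where r: "r \<in> o[at_right 0](\<lambda>h. h)" "\<forall>t\<in>{0..T}. \<forall>h>0.
      (\<forall>v. AE \<omega> in M. \<bar>v - X t \<omega>\<bar> = 1 \<longrightarrow>
         \<bar>cond_probability M (natural_filtration M X t) (\<lambda>\<omega>'. exactly_one_jump_to v (\<lambda>s. X s \<omega>') t (t + h)) \<omega>
            - w (local_time (\<lambda>s. X s \<omega>) v t) * h\<bar> \<le> r h) \<and>
      (AE \<omega> in M. cond_probability M (natural_filtration M X t) (\<lambda>\<omega>'. more_than_one_jump (\<lambda>s. X s \<omega>') t (t + h)) \<omega> \<le> r h)"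
      using jump_rates by blast
    have abs: "\<bar>v - - X t \<omega>\<bar> = \<bar>- v - X t \<omega>\<bar>" for v t \<omega> by linarith
    show "\<exists>r\<in>o[at_right 0](\<lambda>h. h). \<forall>t\<in>{0..T}. \<forall>h>0.
      (\<forall>v. AE \<omega> in M. \<bar>v - - X t \<omega>\<bar> = 1 \<longrightarrow>
         \<bar>cond_probability M (natural_filtration M (\<lambda>t \<omega>. - X t \<omega>) t)
              (\<lambda>\<omega>'. exactly_one_jump_to v (\<lambda>s. - X s \<omega>') t (t + h)) \<omega>
            - w (local_time (\<lambda>s. - X s \<omega>) v t) * h\<bar> \<le> r h) \<and>
      (AE \<omega> in M. cond_probability M (natural_filtration M (\<lambda>t \<omega>. - X t \<omega>) t)
              (\<lambda>\<omega>'. more_than_one_jump (\<lambda>s. - X s \<omega>') t (t + h)) \<omega> \<le> r h)"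
      unfolding filt one many lt abs
    proof (intro bexI[OF _ r(1)] ballI allI impI)
      fix t h :: real assume "t \<in> {0..T}" "0 < h"
      note rates = r(2)[rule_format, OF this]
      show "(\<forall>v. AE \<omega> in M. \<bar>- v - X t \<omega>\<bar> = 1 \<longrightarrow>
         \<bar>cond_probability M (natural_filtration M X t) (\<lambda>\<omega>'. exactly_one_jump_to (- v) (\<lambda>s. X s \<omega>') t (t + h)) \<omega>
            - w (local_time (\<lambda>s. X s \<omega>) (- v) t) * h\<bar> \<le> r h) \<and>
      (AE \<omega> in M. cond_probability M (natural_filtration M X t) (\<lambda>\<omega>'. more_than_one_jump (\<lambda>s. X s \<omega>') t (t + h)) \<omega> \<le> r h)"
        by (rule conjI[OF allI[OF spec[OF conjunct1[OF rates]]] conjunct2[OF rates]])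
    qed
  qed
qed

section \<open>The escape event is a null set\<close>

context vrjp_monotone
begin

text \<open>\<open>prob_reach_bound\<close> for the process and for its reflection, which has the
  same local time at \<open>0\<close>.\<close>

lemma prob_far_bound:
  assumes T: "0 < T" and K: "1 \<le> K" and X0: "AE \<omega> in M. X 0 \<omega> = 0"
  shows "prob {\<omega> \<in> space M. int n \<le> \<bar>X T \<omega>\<bar> \<and> local_time (path \<omega>) 0 T \<le> K - 1} * (n * (eta / 4)) \<le> 2 * (K - 1)\<^sup>2"
proof -
  interpret R: vrjp_monotone M w "\<lambda>t \<omega>. - X t \<omega>"
    by (intro vrjp_monotone.intro vrjp_uminus reinforcement_weight_axioms vrjp_axioms)
  let ?A = "{\<omega> \<in> space M. int n \<le> X T \<omega> \<and> local_time (path \<omega>) 0 T \<le> K - 1}"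
  let ?B = "{\<omega> \<in> space M. int n \<le> - X T \<omega> \<and> local_time (path \<omega>) 0 T \<le> K - 1}"
  have AB: "?A \<in> sets M" "?B \<in> sets M"
    using T by (auto intro!: position_local_time_measurable)
  have "indicat_real {0} (- X s \<omega>) = indicat_real {0} (X s \<omega>)" for s \<omega>
    by (simp add: indicator_def)
  then have lt: "local_time (\<lambda>s. - X s \<omega>) 0 T = local_time (path \<omega>) 0 T" for \<omega>
    by (simp add: local_time_def)
  have "{\<omega> \<in> space M. int n \<le> \<bar>X T \<omega>\<bar> \<and> local_time (path \<omega>) 0 T \<le> K - 1} = ?A \<union> ?B"
    by auto
  then have "prob {\<omega> \<in> space M. int n \<le> \<bar>X T \<omega>\<bar> \<and> local_time (path \<omega>) 0 T \<le> K - 1} * (n * (eta / 4))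
     \<le> (prob ?A + prob ?B) * (n * (eta / 4))"
    using measure_Un_le[OF AB] eta_pos by (simp add: mult_right_mono)
  also have "\<dots> \<le> (K - 1)\<^sup>2 + (K - 1)\<^sup>2"
    using prob_reach_bound[OF T K X0, of n] R.prob_reach_bound[OF T K, of n] X0
    by (simp add: lt distrib_right)
  finally show ?thesis by simp
qed

text \<open>A countable description, for measurability: by \<open>cadlag_rational\<close> a lower
  bound at all rationals from \<open>m\<close> on holds at all real times from \<open>m\<close>
  on.\<close>

lemma escape_iff:
  assumes "\<omega> \<in> space M"
  shows "filterlim (\<lambda>t. \<bar>X t \<omega>\<bar>) at_top at_top \<longleftrightarrow>
    (\<forall>n::nat. \<exists>m::nat. \<forall>q::rat. real m \<le> of_rat q \<longrightarrow> int n \<le> \<bar>X (max 0 (of_rat q)) \<omega>\<bar>)"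
proof
  assume L: "filterlim (\<lambda>t. \<bar>X t \<omega>\<bar>) at_top at_top"
  show "\<forall>n::nat. \<exists>m::nat. \<forall>q::rat. real m \<le> of_rat q \<longrightarrow> int n \<le> \<bar>X (max 0 (of_rat q)) \<omega>\<bar>"
  proof
    fix n :: nat
    have "eventually (\<lambda>t. int n \<le> \<bar>X t \<omega>\<bar>) at_top"
      using L by (simp add: filterlim_at_top)
    then obtain b where b: "\<And>t. b \<le> t \<Longrightarrow> int n \<le> \<bar>X t \<omega>\<bar>"
      by (auto simp: eventually_at_top_linorder)
    obtain m :: nat where "b \<le> real m" using real_arch_simple by blast
    then have "int n \<le> \<bar>X (max 0 (of_rat q)) \<omega>\<bar>" if "real m \<le> of_rat q" for q
      using that by (intro b) linarith
    then show "\<exists>m::nat. \<forall>q::rat. real m \<le> of_rat q \<longrightarrow> int n \<le> \<bar>X (max 0 (of_rat q)) \<omega>\<bar>" by blast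
  qed
next
  assume R: "\<forall>n::nat. \<exists>m::nat. \<forall>q::rat. real m \<le> of_rat q \<longrightarrow> int n \<le> \<bar>X (max 0 (of_rat q)) \<omega>\<bar>"
  show "filterlim (\<lambda>t. \<bar>X t \<omega>\<bar>) at_top at_top"
    unfolding filterlim_at_top
  proof
    fix z :: int
    obtain m :: nat where m: "\<And>q::rat. real m \<le> of_rat q \<Longrightarrow> int (nat z) \<le> \<bar>X (max 0 (of_rat q)) \<omega>\<bar>"
      using R by blast
    have "z \<le> \<bar>X t \<omega>\<bar>" if t: "real m \<le> t" for t
    proof -
      have "0 \<le> t" using t by linarith
      with cadlag_rational[OF cadlag_paths[OF assms], of t "t + 1"] obtain p
        where p: "p \<in> \<rat>" "t < p" "X p \<omega> = X t \<omega>" by auto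
      then obtain q :: rat where q: "p = of_rat q" by (auto elim: Rats_cases)
      have "real m \<le> of_rat q" "max 0 (of_rat q) = p" using t \<open>0 \<le> t\<close> p q by auto
      with m[of q] have "int (nat z) \<le> \<bar>X t \<omega>\<bar>" by (simp only: p)
      then show ?thesis by (rule order_trans[rotated]) simp
    qed
    then show "eventually (\<lambda>t. z \<le> \<bar>X t \<omega>\<bar>) at_top"
      by (auto simp: eventually_at_top_linorder)
  qed
qed

lemma escape_measurable:
  "{\<omega> \<in> space M. filterlim (\<lambda>t. \<bar>X t \<omega>\<bar>) at_top at_top} \<in> sets M"
proof -
  have "{\<omega> \<in> space M. \<forall>n::nat. \<exists>m::nat. \<forall>q::rat. real m \<le> of_rat q \<longrightarrow> int n \<le> \<bar>X (max 0 (of_rat q)) \<omega>\<bar>} \<in> sets M"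
  proof (intro sets.sets_Collect_countable_All sets.sets_Collect_countable_Ex sets.sets_Collect_imp sets.sets_Collect_const)
    fix n :: nat and q :: rat
    have "X (max 0 (of_rat q)) -` {z. int n \<le> \<bar>z\<bar>} \<inter> space M \<in> sets M"
      by (rule measurable_sets[OF measurable_X_rat]) simp
    also have "X (max 0 (of_rat q)) -` {z. int n \<le> \<bar>z\<bar>} \<inter> space M = {\<omega> \<in> space M. int n \<le> \<bar>X (max 0 (of_rat q)) \<omega>\<bar>}"
      by auto
    finally show "{\<omega> \<in> space M. int n \<le> \<bar>X (max 0 (of_rat q)) \<omega>\<bar>} \<in> sets M" .
  qed
  then show ?thesis
    by (rule back_subst[of "\<lambda>S. S \<in> sets M"]) (intro Collect_cong conj_cong refl escape_iff[symmetric])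
qed

text \<open>Beyond some time the walk avoids \<open>0\<close> and the local time there is frozen;
  before, it is at most 1 plus the elapsed time.\<close>

lemma escape_local_time_bounded:
  assumes \<omega>: "\<omega> \<in> space M" and "filterlim (\<lambda>t. \<bar>X t \<omega>\<bar>) at_top at_top"
  shows "\<exists>k::nat. \<forall>m::nat. local_time (path \<omega>) 0 (real m) \<le> real k"
proof -
  have "eventually (\<lambda>t. 1 \<le> \<bar>X t \<omega>\<bar>) at_top"
    using assms(2) by (simp add: filterlim_at_top)
  then obtain b where b: "\<And>t. b \<le> t \<Longrightarrow> 1 \<le> \<bar>X t \<omega>\<bar>"
    by (auto simp: eventually_at_top_linorder)
  obtain k :: nat where k: "b \<le> real k" using real_arch_simple by blast
  have "local_time (path \<omega>) 0 (real m) \<le> real (Suc k)" for m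
  proof (cases "m \<le> k")
    case True
    then show ?thesis using local_time_le[OF cadlag_paths[OF \<omega>], of "real m" 0] by simp
  next
    case False
    have "X t \<omega> \<noteq> 0" if "real k \<le> t" for t using b[of t] k that by auto
    then have "local_time (path \<omega>) 0 (real m) = local_time (path \<omega>) 0 (real k)"
      using False by (intro local_time_away[OF cadlag_paths[OF \<omega>]]) auto
    then show ?thesis using local_time_le[OF cadlag_paths[OF \<omega>], of "real k" 0] by simp
  qed
  then show ?thesis by blast
qed

text \<open>On escape there is a \<open>k\<close> bounding the local time of \<open>0\<close>, and
  for every \<open>n\<close> the walk is eventually at distance at least \<open>n\<close>. For fixed
  \<open>k\<close> the probability of the latter is of order \<open>1 / n\<close>, so intersecting
  over \<open>n\<close> gives a null set, and there are countably many \<open>k\<close>.\<close>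

lemma prob_escape:
  assumes X0: "AE \<omega> in M. X 0 \<omega> = 0"
  shows "prob {\<omega> \<in> space M. filterlim (\<lambda>t. \<bar>X t \<omega>\<bar>) at_top at_top} = 0"
proof -
  let ?E = "{\<omega> \<in> space M. filterlim (\<lambda>t. \<bar>X t \<omega>\<bar>) at_top at_top}"
  let ?A = "\<lambda>k n m. {\<omega> \<in> space M. int n \<le> \<bar>X (real m) \<omega>\<bar> \<and> local_time (path \<omega>) 0 (real m) \<le> real k}"
  \<comment> \<open>A limit inferior over integer times; \<open>Suc m\<close> keeps the times
    positive, as \<open>prob_far_bound\<close> demands.\<close>
  define C where "C k n = (\<Union>j. \<Inter>m\<in>{j..}. ?A k n (Suc m))" for k n
  have AM: "?A k n m \<in> sets M" for k n m
    by (rule position_local_time_measurable) simp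
  have IM: "(\<Inter>m\<in>{j..}. ?A k n (Suc m)) \<in> sets M" for k n and j :: nat
  proof (rule sets.countable_INT')
    show "(\<lambda>m. ?A k n (Suc m)) ` {j..} \<subseteq> sets M" using AM by blast
  qed auto
  have CM: "C k n \<in> sets M" for k n
    unfolding C_def by (rule sets.countable_UN) (use IM in blast)
  have Cb: "prob (C k n) * (n * (eta / 4)) \<le> 2 * (real k)\<^sup>2" for k n
  proof -
    have "(\<lambda>j. prob (\<Inter>m\<in>{j..}. ?A k n (Suc m))) \<longlonglongrightarrow> prob (C k n)"
      unfolding C_def
    proof (rule finite_Lim_measure_incseq)
      show "range (\<lambda>j. \<Inter>m\<in>{j..}. ?A k n (Suc m)) \<subseteq> sets M" using IM by blast
      show "incseq (\<lambda>j. \<Inter>m\<in>{j..}. ?A k n (Suc m))"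
        by (intro monoI INT_anti_mono) auto
    qed
    then have lim: "(\<lambda>j. prob (\<Inter>m\<in>{j..}. ?A k n (Suc m)) * (n * (eta / 4))) \<longlonglongrightarrow> prob (C k n) * (n * (eta / 4))"
      by (intro tendsto_intros)
    have "prob (\<Inter>m\<in>{j..}. ?A k n (Suc m)) * (n * (eta / 4)) \<le> 2 * (real k)\<^sup>2" for j
    proof -
      have "prob (\<Inter>m\<in>{j..}. ?A k n (Suc m)) \<le> prob (?A k n (Suc j))"
        by (intro finite_measure_mono AM INT_lower) simp
      then have "prob (\<Inter>m\<in>{j..}. ?A k n (Suc m)) * (n * (eta / 4)) \<le> prob (?A k n (Suc j)) * (n * (eta / 4))"
        using eta_pos by (intro mult_right_mono) auto
      \<comment> \<open>\<open>prob_far_bound\<close> with \<open>K = k + 1\<close>. The bound does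
        not depend on the time, hence passes to the limit in \<open>j\<close>.\<close>
      also have "\<dots> \<le> 2 * (real k)\<^sup>2"
        using prob_far_bound[of "real (Suc j)" "real k + 1" n] X0 by simp
      finally show ?thesis .
    qed
    then show ?thesis by (intro LIMSEQ_le_const2[OF lim]) auto
  qed
  have "(\<Inter>n. C k n) \<in> null_sets M" for k
  proof -
    have meas: "(\<Inter>n. C k n) \<in> sets M" using CM by blast
    have "prob (\<Inter>n. C k n) \<le> 2 * (real k)\<^sup>2 / (eta / 4) * (1 / real (Suc n))" for n
    proof -
      have "prob (\<Inter>n. C k n) \<le> prob (C k (Suc n))"
        using CM by (intro finite_measure_mono) auto
      also have "\<dots> \<le> 2 * (real k)\<^sup>2 / (Suc n * (eta / 4))"
        using Cb[of k "Suc n"] eta_pos by (subst pos_le_divide_eq) auto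
      finally show ?thesis by (simp add: field_simps)
    qed
    moreover have "(\<lambda>n. 2 * (real k)\<^sup>2 / (eta / 4) * (1 / real (Suc n))) \<longlonglongrightarrow> 2 * (real k)\<^sup>2 / (eta / 4) * 0"
      by (intro tendsto_intros LIMSEQ_Suc[OF lim_1_over_n])
    ultimately have "prob (\<Inter>n. C k n) \<le> 0"
      by (intro LIMSEQ_le_const[of "\<lambda>n. 2 * (real k)\<^sup>2 / (eta / 4) * (1 / real (Suc n))"]) auto
    then have "prob (\<Inter>n. C k n) = 0"
      using measure_nonneg[of M "\<Inter>n. C k n"] by (rule order_antisym)
    then show ?thesis using meas
      by (simp add: null_sets_def emeasure_eq_measure)
  qed
  then have "(\<Union>k. \<Inter>n. C k n) \<in> null_sets M" by (intro null_sets_UN) auto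
  moreover have "?E \<subseteq> (\<Union>k. \<Inter>n. C k n)"
  proof
    fix \<omega> assume "\<omega> \<in> ?E"
    then have \<omega>: "\<omega> \<in> space M" and L: "filterlim (\<lambda>t. \<bar>X t \<omega>\<bar>) at_top at_top" by auto
    obtain k :: nat where k: "\<And>m::nat. local_time (path \<omega>) 0 (real m) \<le> real k"
      using escape_local_time_bounded[OF \<omega> L] by blast
    have "\<omega> \<in> C k n" for n
    proof -
      have "eventually (\<lambda>t. int n \<le> \<bar>X t \<omega>\<bar>) at_top"
        using L by (simp add: filterlim_at_top)
      then obtain b where b: "\<And>t. b \<le> t \<Longrightarrow> int n \<le> \<bar>X t \<omega>\<bar>"
        by (auto simp: eventually_at_top_linorder)
      obtain j :: nat where j: "b \<le> real j" using real_arch_simple by blast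
      have "\<omega> \<in> ?A k n (Suc m)" if "j \<le> m" for m
        using \<omega> k[of "Suc m"] b[of "real (Suc m)"] j that by simp
      then show ?thesis unfolding C_def by blast
    qed
    then show "\<omega> \<in> (\<Union>k. \<Inter>n. C k n)" by blast
  qed
  ultimately have "?E \<in> null_sets M"
    using null_sets_subset[OF _ escape_measurable] by blast
  then show ?thesis by (simp add: null_setsD1 measure_def)
qed

end

theorem theorem2p3:
  fixes w :: "real \<Rightarrow> real" and M :: "'a measure" and X :: "real \<Rightarrow> 'a \<Rightarrow> int"
  assumes w_nonneg: "\<And>x. 0 \<le> x \<Longrightarrow> 0 \<le> w x"
    and w_strict_mono: "strict_mono_on {0..} w"
    and w_right_cont: "\<And>x. 0 \<le> x \<Longrightarrow> continuous (at_right x) w"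
    and w_0: "w 0 = 0" and w_1: "w 1 = 1"
    and X_vrjp: "vrjp M w X"
    and X_start: "AE \<omega> in M. X 0 \<omega> = 0"
  shows "{\<omega> \<in> space M. filterlim (\<lambda>t. \<bar>X t \<omega>\<bar>) at_top at_top} \<in> sets M \<and>
    measure M {\<omega> \<in> space M. filterlim (\<lambda>t. \<bar>X t \<omega>\<bar>) at_top at_top} = 0"
proof -
  have "reinforcement_weight w"
  proof
    show "w x \<le> w y" if "1 \<le> x" "x \<le> y" for x y
      using strict_mono_on_leD[OF w_strict_mono, of x y] that by simp
    show "1 < w 2"
      using strict_mono_onD[OF w_strict_mono, of 1 2] w_1 by simp
  qed (fact w_1)
  then interpret vrjp_monotone M w X
    using X_vrjp by (simp add: vrjp_monotone_def)
  show ?thesis using escape_measurable prob_escape[OF X_start] by simp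
qed

end
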